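(* Let $M$ be a binary gammoid. Then the es-splitting matroid $M_T^e$ is a binary gammoid for every $T \subseteq E(M)$ with $|T| \geq 2$ and every $e \in T$ if and only if $M$ does not contain a minor isomorphic to $M(G_7)$.
   Context: A binary gammoid is a gammoid that is representable over $GF(2)$. $M(G)$ denotes the cycle matroid of a graph $G$ (parallel edges allowed). Element splitting: let $B$ be a binary matroid, $H \subseteq E(B)$, and let $A$ be a matrix over $GF(2)$ representing $B$. Let $A_H'$ be obtained from $A$ by adjoining a new last row whose entries are $1$ in the columns corresponding to the elements of $H$ and $0$ elsewhere, and then adjoining one new column (labelled by a new element $a \notin E(B)$) whose entries are all $0$ except for the last row, where the entry is $1$. The element splitting matroid $B_H'$ is the vector matroid of $A_H'$, on the ground set $E(B) \cup \{a\}$. es-splitting: let $B$ be a binary matroid represented over $GF(2)$ by a matrix $A$, let $H \subseteq E(B)$ and $e \in H$. Let $N$ be the matrix obtained from $A$ by adjoining a new column labelled $\gamma \notin E(B)$ equal to the column labelled $e$, and let $L$ be the vector matroid of $N$ (so $E(L) = E(B)\cup\{\gamma\}$ and $H \subseteq E(L)$ does not contain $\gamma$). The es-splitting matroid $B_H^e$ is the element splitting matroid $L_H'$. $G_7$ is the graph on three vertices $u,v,w$ with four edges: one edge joining $u$ and $v$, one edge joining $u$ and $w$, and two parallel edges joining $v$ and $w$. *)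

theory Defs
  imports "HOL-Library.Z2" "Graph_Theory.Vertex_Walk"
begin

section \<open>Finite matroids\<close>

record 'a indep_system =
  ground :: "'a set"
  indep :: "'a set \<Rightarrow> bool"

locale matroid =
  fixes M :: "'a indep_system"
  assumes finite_ground: "finite (ground M)"
    and indep_subset_ground: "indep M X \<Longrightarrow> X \<subseteq> ground M"
    and indep_empty: "indep M {}"
    and indep_subset: "indep M X \<Longrightarrow> Y \<subseteq> X \<Longrightarrow> indep M Y"
    and indep_exchange:
      "indep M X \<Longrightarrow> indep M Y \<Longrightarrow> card X < card Y \<Longrightarrow> \<exists>y \<in> Y - X. indep M (insert y X)"

definition matroid_iso :: "'a indep_system \<Rightarrow> 'b indep_system \<Rightarrow> bool" where
  "matroid_iso M N \<longleftrightarrow>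
     (\<exists>f. bij_betw f (ground M) (ground N) \<and> (\<forall>X \<subseteq> ground M. indep M X \<longleftrightarrow> indep N (f ` X)))"

definition delete :: "'a indep_system \<Rightarrow> 'a set \<Rightarrow> 'a indep_system" where
  "delete M X = \<lparr>ground = ground M - X, indep = (\<lambda>I. indep M I \<and> I \<inter> X = {})\<rparr>"

definition basis_of :: "'a indep_system \<Rightarrow> 'a set \<Rightarrow> 'a set \<Rightarrow> bool" where
  "basis_of M Y J \<longleftrightarrow>
     J \<subseteq> Y \<and> indep M J \<and> (\<forall>J'. J \<subseteq> J' \<and> J' \<subseteq> Y \<and> indep M J' \<longrightarrow> J' = J)"

definition contract :: "'a indep_system \<Rightarrow> 'a set \<Rightarrow> 'a indep_system" where
  "contract M Y =
     \<lparr>ground = ground M - Y,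
      indep = (\<lambda>I. I \<subseteq> ground M - Y \<and> (\<exists>J. basis_of M Y J \<and> indep M (I \<union> J)))\<rparr>"

definition is_minor :: "'a indep_system \<Rightarrow> 'a indep_system \<Rightarrow> bool" where
  "is_minor N M \<longleftrightarrow>
     (\<exists>X Y. X \<subseteq> ground M \<and> Y \<subseteq> ground M \<and> X \<inter> Y = {} \<and> N = contract (delete M X) Y)"

definition has_minor_iso :: "'a indep_system \<Rightarrow> 'b indep_system \<Rightarrow> bool" where
  "has_minor_iso M N \<longleftrightarrow> (\<exists>N'. is_minor N' M \<and> matroid_iso N' N)"


section \<open>Vector matroids\<close>

text \<open>
  A matrix with \<open>m\<close> rows whose columns are labelled by the elements of a set \<open>E\<close> is given
  by \<open>m\<close> and a function \<open>A\<close>, where \<open>A i x\<close> is the entry in row \<open>i < m\<close> and column \<open>x \<in> E\<close>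
  (all other values of \<open>A\<close> are irrelevant).  Linear independence is that of the family of
  columns, so two equal columns with different labels are dependent.
\<close>

definition columns_indep :: "nat \<Rightarrow> (nat \<Rightarrow> 'a \<Rightarrow> 'f::field) \<Rightarrow> 'a set \<Rightarrow> bool" where
  "columns_indep m A X \<longleftrightarrow>
     (\<forall>c. (\<forall>i<m. (\<Sum>x\<in>X. c x * A i x) = 0) \<longrightarrow> (\<forall>x\<in>X. c x = 0))"

definition vector_matroid :: "'a set \<Rightarrow> nat \<Rightarrow> (nat \<Rightarrow> 'a \<Rightarrow> 'f::field) \<Rightarrow> 'a indep_system" where
  "vector_matroid E m A = \<lparr>ground = E, indep = (\<lambda>X. X \<subseteq> E \<and> columns_indep m A X)\<rparr>"

definition represents :: "nat \<Rightarrow> (nat \<Rightarrow> 'a \<Rightarrow> 'f::field) \<Rightarrow> 'a indep_system \<Rightarrow> bool" where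
  "represents m A M \<longleftrightarrow> M = vector_matroid (ground M) m A"

definition binary :: "'a indep_system \<Rightarrow> bool" where
  "binary M \<longleftrightarrow> matroid M \<and> (\<exists>m (A :: nat \<Rightarrow> 'a \<Rightarrow> bit). represents m A M)"


section \<open>Element splitting and es-splitting\<close>

text \<open>
  New elements are supplied by the option type: if \<open>E\<close> is the old ground set then the new
  ground set is \<open>Some ` E\<close> together with the new element \<open>None\<close>.  Hence in the es-splitting
  matroid the old elements \<open>x\<close> appear as \<open>Some (Some x)\<close>, the copy \<open>\<gamma>\<close> of \<open>e\<close> is \<open>Some None\<close>,
  and the element \<open>a\<close> added by the element splitting is \<open>None\<close>.
\<close>

definition split_matrix :: "'a set \<Rightarrow> nat \<Rightarrow> (nat \<Rightarrow> 'a \<Rightarrow> bit) \<Rightarrow> nat \<Rightarrow> 'a option \<Rightarrow> bit" where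
  "split_matrix H m A i z =
     (case z of
        None \<Rightarrow> (if i = m then 1 else 0)
      | Some x \<Rightarrow> (if i = m then (if x \<in> H then 1 else 0) else A i x))"

definition copy_column :: "'a \<Rightarrow> (nat \<Rightarrow> 'a \<Rightarrow> bit) \<Rightarrow> nat \<Rightarrow> 'a option \<Rightarrow> bit" where
  "copy_column e A i z = (case z of None \<Rightarrow> A i e | Some x \<Rightarrow> A i x)"

text \<open>
  The matroids below are defined through a chosen representing matrix; that the choice is
  immaterial is shown in \<open>element_splitting_eq\<close> and \<open>parallel_copy_eq\<close>.
\<close>

definition element_splitting :: "'a indep_system \<Rightarrow> 'a set \<Rightarrow> 'a option indep_system" where
  "element_splitting B H =
     (let (m, A) = (SOME (m, A). represents m A B)
      in vector_matroid (insert None (Some ` ground B)) (Suc m) (split_matrix H m A))"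

definition parallel_copy :: "'a indep_system \<Rightarrow> 'a \<Rightarrow> 'a option indep_system" where
  "parallel_copy B e =
     (let (m, A) = (SOME (m, A :: nat \<Rightarrow> 'a \<Rightarrow> bit). represents m A B)
      in vector_matroid (insert None (Some ` ground B)) m (copy_column e A))"

definition es_splitting :: "'a indep_system \<Rightarrow> 'a set \<Rightarrow> 'a \<Rightarrow> 'a option option indep_system" where
  "es_splitting B H e = element_splitting (parallel_copy B e) (Some ` H)"


section \<open>Gammoids\<close>

text \<open>
  \<open>linked D X B\<close>: there are pairwise vertex-disjoint directed paths of \<open>D\<close>, one starting at
  each vertex of \<open>X\<close>, all ending in \<open>B\<close>.  Paths consisting of a single vertex are allowed.
\<close>

definition linked :: "('v, 'e) pre_digraph \<Rightarrow> 'v set \<Rightarrow> 'v set \<Rightarrow> bool" where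
  "linked D X B \<longleftrightarrow>
     (\<exists>P. (\<forall>x\<in>X. vpath (P x) D \<and> hd (P x) = x \<and> last (P x) \<in> B) \<and>
          (\<forall>x\<in>X. \<forall>y\<in>X. x \<noteq> y \<longrightarrow> set (P x) \<inter> set (P y) = {}))"

text \<open>
  The ground set of a gammoid is a set of vertices of a finite digraph.  As HOL cannot
  quantify over the type of vertices, the digraph lives on natural numbers and the ground
  set is embedded into its vertices by an injection \<open>\<phi>\<close>; for finite digraphs this is no
  restriction.
\<close>

definition gammoid :: "'a indep_system \<Rightarrow> bool" where
  "gammoid M \<longleftrightarrow> matroid M \<and>
     (\<exists>(D :: (nat, nat) pre_digraph) B \<phi>.
        fin_digraph D \<and> B \<subseteq> verts D \<and>
        inj_on \<phi> (ground M) \<and> \<phi> ` ground M \<subseteq> verts D \<and>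
        (\<forall>X \<subseteq> ground M. indep M X \<longleftrightarrow> linked D (\<phi> ` X) B))"

definition binary_gammoid :: "'a indep_system \<Rightarrow> bool" where
  "binary_gammoid M \<longleftrightarrow> gammoid M \<and> binary M"


section \<open>Cycle matroids\<close>

text \<open>Undirected multigraphs; an edge with a single end is a loop.\<close>

record ('v, 'e) multigraph =
  nodes :: "'v set"
  edges :: "'e set"
  ends :: "'e \<Rightarrow> 'v set"

text \<open>
  A cycle has vertices \<open>vs\<close> and edges \<open>es\<close> in cyclic order; length 1 is a loop and length 2 a
  pair of parallel edges.
\<close>

definition is_cycle :: "('v, 'e) multigraph \<Rightarrow> 'v list \<Rightarrow> 'e list \<Rightarrow> bool" where
  "is_cycle G vs es \<longleftrightarrow>
     es \<noteq> [] \<and> length vs = length es \<and> distinct vs \<and> distinct es \<and>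
     set vs \<subseteq> nodes G \<and> set es \<subseteq> edges G \<and>
     (\<forall>i < length es. ends G (es ! i) = {vs ! i, vs ! (Suc i mod length es)})"

definition cycle_matroid :: "('v, 'e) multigraph \<Rightarrow> 'e indep_system" where
  "cycle_matroid G =
     \<lparr>ground = edges G,
      indep = (\<lambda>X. X \<subseteq> edges G \<and> \<not> (\<exists>vs es. is_cycle G vs es \<and> set es \<subseteq> X))\<rparr>"

text \<open>The vertices \<open>u, v, w\<close> are \<open>0, 1, 2\<close>.\<close>

definition G7 :: "(nat, nat) multigraph" where
  "G7 = \<lparr>nodes = {0, 1, 2}, edges = {0, 1, 2, 3},
         ends = (\<lambda>i. [{0, 1}, {0, 2}, {1, 2}, {1, 2}] ! i)\<rparr>"


section \<open>Independence of the chosen representation\<close>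

text \<open>
  Over \<open>GF(2)\<close> the sets of columns with sum zero are determined by the independent sets.
\<close>

definition zero_sum :: "nat \<Rightarrow> (nat \<Rightarrow> 'a \<Rightarrow> bit) \<Rightarrow> 'a set \<Rightarrow> bool" where
  "zero_sum m A Z \<longleftrightarrow> (\<forall>i<m. (\<Sum>x\<in>Z. A i x) = 0)"

lemma columns_indep_iff:
  fixes A :: "nat \<Rightarrow> 'a \<Rightarrow> bit"
  assumes "finite X"
  shows "columns_indep m A X \<longleftrightarrow> (\<forall>Z \<subseteq> X. zero_sum m A Z \<longrightarrow> Z = {})"
proof
  assume l: "columns_indep m A X"
  show "\<forall>Z \<subseteq> X. zero_sum m A Z \<longrightarrow> Z = {}"
  proof (intro allI impI)
    fix Z assume Z: "Z \<subseteq> X" "zero_sum m A Z"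
    have "(\<Sum>x\<in>X. (if x \<in> Z then 1 else 0) * A i x) = (\<Sum>x\<in>Z. A i x)" for i
      using assms Z(1) by (intro sum.mono_neutral_cong_right) auto
    then have "\<forall>x\<in>X. (if x \<in> Z then 1 else 0 :: bit) = 0"
      using l[unfolded columns_indep_def, rule_format, of "\<lambda>x. if x \<in> Z then 1 else 0"] Z(2)
      by (simp add: zero_sum_def)
    then show "Z = {}" using Z(1) by (auto split: if_splits)
  qed
next
  assume r: "\<forall>Z \<subseteq> X. zero_sum m A Z \<longrightarrow> Z = {}"
  show "columns_indep m A X"
    unfolding columns_indep_def
  proof (intro allI impI)
    fix c assume c: "\<forall>i<m. (\<Sum>x\<in>X. c x * A i x) = 0"
    let ?Z = "{x \<in> X. c x \<noteq> 0}"
    have "(\<Sum>x\<in>?Z. A i x) = (\<Sum>x\<in>X. c x * A i x)" for i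
      using assms by (intro sum.mono_neutral_cong_left) auto
    then have "zero_sum m A ?Z" unfolding zero_sum_def using c by simp
    then have "?Z = {}" using r[THEN spec, of ?Z] by blast
    then show "\<forall>x\<in>X. c x = 0" by auto
  qed
qed

lemma zero_sum_Diff:
  assumes "finite Z" "C \<subseteq> Z" "zero_sum m A C"
  shows "zero_sum m A (Z - C) \<longleftrightarrow> zero_sum m A Z"
proof -
  have "sum (A i) Z = sum (A i) (Z - C)" if "i < m" for i
    using sum.subset_diff[OF assms(2,1), of "A i"] assms(3) that
    by (simp add: zero_sum_def del: add_bit_eq_xor)
  then show ?thesis by (simp add: zero_sum_def)
qed

lemma zero_sum_transfer:
  assumes "\<And>X. X \<subseteq> E \<Longrightarrow> columns_indep m A X = columns_indep n A' X"
    and "finite Z" "Z \<subseteq> E" "zero_sum m A Z"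
  shows "zero_sum n A' Z"
  using assms(2-)
proof (induction "card Z" arbitrary: Z rule: less_induct)
  case less
  show ?case
  proof (cases "Z = {}")
    case True
    then show ?thesis by (simp add: zero_sum_def)
  next
    case False
    let ?dep = "\<lambda>C. C \<subseteq> Z \<and> \<not> columns_indep m A C"
    have dZ: "?dep Z" using columns_indep_iff[OF less.prems(1)] less.prems(3) False by blast
    define C where "C = arg_min card ?dep"
    have C: "?dep C" unfolding C_def by (rule arg_min_natI[of ?dep, OF dZ])
    have min: "card C \<le> card D" if "?dep D" for D
      unfolding C_def by (rule arg_min_nat_le[of ?dep, OF that])
    have fC: "finite C" using C less.prems(1) finite_subset by blast
    have proper: "columns_indep m A D" if "D \<subset> C" for D
      using min[of D] C that psubset_card_mono[OF fC that] by fastforce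
    have zs: "zero_sum k F C" if eq: "\<And>X. X \<subseteq> C \<Longrightarrow> columns_indep m A X = columns_indep k F X" for k F
    proof -
      have "\<not> columns_indep k F C" using C eq by blast
      then obtain D where D: "D \<subseteq> C" "zero_sum k F D" "D \<noteq> {}"
        using columns_indep_iff[OF fC] by blast
      have "\<not> columns_indep k F D"
        using columns_indep_iff[OF finite_subset[OF D(1) fC]] D by blast
      then have "D = C" using proper eq[OF D(1)] D(1) by blast
      then show ?thesis using D by simp
    qed
    have "zero_sum m A C" by (rule zs) simp
    moreover have CA': "zero_sum n A' C"
      using C less.prems(2) by (intro zs assms(1)) auto
    ultimately have "zero_sum m A (Z - C)"
      using zero_sum_Diff less.prems C by blast
    moreover have "C \<noteq> {}" using C by (auto simp: columns_indep_def)
    then have "card (Z - C) < card Z"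
      using C less.prems(1) by (intro psubset_card_mono) auto
    ultimately have "zero_sum n A' (Z - C)"
      using less.hyps[of "Z - C"] less.prems by auto
    then show ?thesis using zero_sum_Diff CA' less.prems(1) C by blast
  qed
qed

lemma zero_sum_unique:
  assumes "represents m A M" "represents n A' M" "finite (ground M)" "Z \<subseteq> ground M"
  shows "zero_sum m A Z \<longleftrightarrow> zero_sum n A' Z"
proof -
  have eq: "columns_indep m A X = columns_indep n A' X" if "X \<subseteq> ground M" for X
  proof -
    have "vector_matroid (ground M) m A = vector_matroid (ground M) n A'"
      using assms(1,2) by (simp add: represents_def)
    from arg_cong[OF this, of "\<lambda>N. indep N X"] show ?thesis
      using that by (simp add: vector_matroid_def)
  qed
  have Z: "finite Z" using assms(3,4) by (rule rev_finite_subset)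
  show ?thesis
    by (rule iffI) (rule zero_sum_transfer[OF _ Z assms(4)]; simp add: eq)+
qed

lemma vector_matroid_cong:
  fixes A A' :: "nat \<Rightarrow> 'a \<Rightarrow> bit"
  assumes "finite E" "\<And>Z. Z \<subseteq> E \<Longrightarrow> zero_sum m A Z \<longleftrightarrow> zero_sum n A' Z"
  shows "vector_matroid E m A = vector_matroid E n A'"
proof -
  have "columns_indep m A X = columns_indep n A' X" if "X \<subseteq> E" for X
  proof -
    have "zero_sum m A Z \<longleftrightarrow> zero_sum n A' Z" if "Z \<subseteq> X" for Z
      by (rule assms(2)) (use that \<open>X \<subseteq> E\<close> in simp)
    then show ?thesis
      by (simp add: columns_indep_iff[OF finite_subset[OF that assms(1)]] cong: imp_cong)
  qed
  then have "(\<lambda>X. X \<subseteq> E \<and> columns_indep m A X) = (\<lambda>X. X \<subseteq> E \<and> columns_indep n A' X)"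
    by (simp add: fun_eq_iff cong: conj_cong)
  then show ?thesis by (simp add: vector_matroid_def)
qed

lemma add_self_bit: "a + a = (0 :: bit)"
  by (cases a) simp_all

lemma sum_option:
  fixes f :: "'a option \<Rightarrow> bit"
  assumes "finite Z"
  shows "sum f Z = (if None \<in> Z then f None else 0) + (\<Sum>x\<in>{x. Some x \<in> Z}. f (Some x))"
proof -
  have fin: "finite (Some ` {x. Some x \<in> Z})"
    by (rule finite_subset[OF _ assms]) auto
  have Z: "Z = (if None \<in> Z then {None} else {}) \<union> Some ` {x. Some x \<in> Z}"
  proof (intro set_eqI)
    show "z \<in> Z \<longleftrightarrow> z \<in> (if None \<in> Z then {None} else {}) \<union> Some ` {x. Some x \<in> Z}" for z
      by (cases z) auto
  qed
  have "sum f Z = sum f (if None \<in> Z then {None} else {}) + sum f (Some ` {x. Some x \<in> Z})"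
    using sum.union_disjoint[of "if None \<in> Z then {None} else {}" "Some ` {x. Some x \<in> Z}" f]
      fin arg_cong[OF Z, of "sum f"] by (cases "None \<in> Z") (simp_all del: add_bit_eq_xor)
  also have "sum f (Some ` {x. Some x \<in> Z}) = (\<Sum>x\<in>{x. Some x \<in> Z}. f (Some x))"
    by (subst sum.reindex) auto
  finally show ?thesis by (cases "None \<in> Z") (simp_all del: add_bit_eq_xor)
qed

lemma zero_sum_split_matrix:
  assumes "finite Z"
  shows "zero_sum (Suc m) (split_matrix H m A) Z \<longleftrightarrow>
    zero_sum m A {x. Some x \<in> Z} \<and>
    (if None \<in> Z then 1 else 0) + (\<Sum>x\<in>{x. Some x \<in> Z}. if x \<in> H then 1 else 0 :: bit) = 0"
proof -
  let ?Z = "{x. Some x \<in> Z}"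
  have "(\<Sum>z\<in>Z. split_matrix H m A i z) =
      (if i = m then (if None \<in> Z then 1 else 0) + (\<Sum>x\<in>?Z. if x \<in> H then 1 else 0)
       else (\<Sum>x\<in>?Z. A i x))" for i
    unfolding sum_option[OF assms] by (simp add: split_matrix_def del: add_bit_eq_xor)
  then show ?thesis
    unfolding zero_sum_def All_less_Suc by (simp add: conj_commute del: add_bit_eq_xor)
qed

lemma zero_sum_copy_column:
  assumes "finite Z" "e \<notin> S" "{x. Some x \<in> Z} - {e} = S"
  shows "zero_sum m (copy_column e A) Z \<longleftrightarrow>
    zero_sum m A (if (None \<in> Z) = (Some e \<in> Z) then S else insert e S)"
proof -
  have fin: "finite {x. Some x \<in> Z}"
    using finite_vimageI[OF assms(1), of Some] by (simp add: vimage_def)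
  have fS: "finite S" using fin assms(3) by auto
  have cancel: "a + (a + b) = b" for a b :: bit
    by (metis add.assoc add.left_neutral add_self_bit)
  have "{x. Some x \<in> Z} = (if Some e \<in> Z then insert e S else S)" using assms(3) by auto
  then have "(\<Sum>z\<in>Z. copy_column e A i z) =
      (\<Sum>x\<in>(if (None \<in> Z) = (Some e \<in> Z) then S else insert e S). A i x)" for i
    unfolding sum_option[OF assms(1)] using fS assms(2)
    by (cases "None \<in> Z"; cases "Some e \<in> Z")
      (simp_all add: copy_column_def cancel del: add_bit_eq_xor)
  then show ?thesis by (simp add: zero_sum_def)
qed

lemma element_splitting_eq:
  assumes "represents m A B" "finite (ground B)"
  shows "element_splitting B H =
    vector_matroid (insert None (Some ` ground B)) (Suc m) (split_matrix H m A)"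
proof -
  obtain n A' where eq: "(SOME (m, A :: nat \<Rightarrow> 'a \<Rightarrow> bit). represents m A B) = (n, A')"
    by fastforce
  have rep: "represents n A' B"
    using someI[of "\<lambda>(m, A :: nat \<Rightarrow> 'a \<Rightarrow> bit). represents m A B" "(m, A)"] assms(1) eq by auto
  have "zero_sum (Suc n) (split_matrix H n A') Z \<longleftrightarrow> zero_sum (Suc m) (split_matrix H m A) Z"
    if "Z \<subseteq> insert None (Some ` ground B)" for Z
  proof -
    have "finite Z" using that assms(2) finite_subset by fastforce
    moreover have "{x. Some x \<in> Z} \<subseteq> ground B" using that by auto
    ultimately show ?thesis
      by (simp only: zero_sum_split_matrix zero_sum_unique[OF rep assms(1,2)])
  qed
  then show ?thesis
    unfolding element_splitting_def eq Let_def prod.case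
    by (intro vector_matroid_cong) (use assms(2) in auto)
qed

lemma parallel_copy_eq:
  fixes A :: "nat \<Rightarrow> 'a \<Rightarrow> bit"
  assumes "represents m A B" "finite (ground B)" "e \<in> ground B"
  shows "parallel_copy B e = vector_matroid (insert None (Some ` ground B)) m (copy_column e A)"
proof -
  obtain n A' where eq: "(SOME (m, A :: nat \<Rightarrow> 'a \<Rightarrow> bit). represents m A B) = (n, A')"
    by fastforce
  have rep: "represents n A' B"
    using someI[of "\<lambda>(m, A :: nat \<Rightarrow> 'a \<Rightarrow> bit). represents m A B" "(m, A)"] assms(1) eq by auto
  have "zero_sum n (copy_column e A') Z \<longleftrightarrow> zero_sum m (copy_column e A) Z"
    if "Z \<subseteq> insert None (Some ` ground B)" for Z
  proof -
    let ?S = "{x. Some x \<in> Z} - {e}"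
    let ?U = "if (None \<in> Z) = (Some e \<in> Z) then ?S else insert e ?S"
    have "finite Z" using that assms(2) finite_subset by fastforce
    then have copy: "zero_sum k (copy_column e F) Z \<longleftrightarrow> zero_sum k F ?U" for k F
      by (rule zero_sum_copy_column) simp_all
    have "?U \<subseteq> ground B" using that assms(3) by auto
    from zero_sum_unique[OF rep assms(1,2) this] show ?thesis by (simp only: copy)
  qed
  then show ?thesis
    unfolding parallel_copy_def eq Let_def prod.case
    by (intro vector_matroid_cong) (use assms(2) in auto)
qed

end

theory Submission
  imports Defs
begin

text \<open>
  The proof replaces linkings by single maps. A family of disjoint paths from \<open>X\<close> into \<open>B\<close> is
  the same as an injective map \<open>g\<close> that sends every vertex outside \<open>B\<close> to itself or to an
  out-neighbour and has no value in \<open>X\<close>: on the paths \<open>g\<close> is the successor, elsewhere the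
  identity (\<open>linked_iff_step_map\<close>). This is the duality between strict gammoids and
  transversal matroids, and it turns both directions into statements about injections.

  If \<open>M\<close> has an \<open>M(G\<^sub>7)\<close>-minor, some splitting is not a gammoid. Two maps \<open>g\<close>, \<open>h\<close> as
  above can be exchanged along alternating paths, so gammoids are base orderable
  (\<open>gammoid_symmetric_exchange\<close>). Let the minor have the edges \<open>p\<close>, \<open>q\<close> and the parallel
  edges \<open>r\<close>, \<open>s\<close>, and let \<open>J\<close> be a basis of the contracted set. Over \<open>J\<close> the elements \<open>p\<close>,
  \<open>q\<close>, \<open>r\<close>, \<open>s\<close>, \<open>\<gamma>\<close>, \<open>a\<close> of the es-splitting with respect to \<open>T = {p, r}\<close> and \<open>e = p\<close> form
  the cycle matroid of \<open>K\<^sub>4\<close>, whose two complementary Hamiltonian paths \<open>{p, s, a}\<close> and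
  \<open>{q, r, \<gamma>}\<close> violate base orderability. Base orderability compares two independent
  sets element by element, so \<open>J\<close> can be added to both of them and the violation persists in
  the splitting of \<open>M\<close>.

  If \<open>M\<close> has no \<open>M(G\<^sub>7)\<close>-minor, take a basis \<open>B\<close> and write every other element \<open>p\<close> as the
  sum of a set \<open>F p\<close> of basis elements. Two overlapping but distinct sets \<open>F p\<close>, \<open>F q\<close> would
  give an \<open>M(G\<^sub>7)\<close>-minor on \<open>p\<close>, \<open>q\<close> and two basis elements
  (\<open>G7_minor_if_fundamental_sets_overlap\<close>), so the sets \<open>F p\<close> are pairwise equal or disjoint.
  For a suitable basis the parallel copy of \<open>e\<close> preserves this; the splitting then adds the
  new element \<open>a\<close> to the basis and to some of the sets. A matroid whose fundamental sets are
  pairwise equal or disjoint up to one element \<open>a\<close> is a gammoid: each occurring set becomes a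
  hub vertex through which all elements with that fundamental set must pass
  (\<open>gammoid_fundamental_family\<close>).
\<close>

section \<open>Linkings as injective maps\<close>

text \<open>
  In the bipartite graph with an edge from every \<open>v \<in> V - B\<close> to \<open>v\<close> itself and to its
  out-neighbours, \<open>g\<close> is a matching that covers \<open>V - B\<close>.
\<close>

definition step_map :: "('v \<times> 'v) set \<Rightarrow> 'v set \<Rightarrow> 'v set \<Rightarrow> ('v \<Rightarrow> 'v) \<Rightarrow> bool" where
  "step_map R V B g \<longleftrightarrow> inj_on g (V - B) \<and> (\<forall>v\<in>V - B. g v = v \<or> (v, g v) \<in> R)"

lemma step_mapD:
  assumes "step_map R V B g" "v \<in> V" "v \<notin> B"
  shows "g v = v \<or> (v, g v) \<in> R"
  using assms by (simp add: step_map_def)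

lemma step_map_closed:
  assumes "step_map R V B g" "R \<subseteq> V \<times> V" "v \<in> V - B"
  shows "g v \<in> V"
  using step_mapD[OF assms(1), of v] assms(2,3) by auto

lemma vwalk_arcs_conv_nth:
  "set (vwalk_arcs p) = {(p ! i, p ! Suc i) | i. Suc i < length p}"
proof (induction p rule: vwalk_arcs.induct)
  case (3 x y xs)
  have "{(x, y)} \<union> {((y # xs) ! i, (y # xs) ! Suc i) | i. Suc i < length (y # xs)} =
    {((x # y # xs) ! i, (x # y # xs) ! Suc i) | i. Suc i < length (x # y # xs)}"
    (is "?L = ?R")
  proof
    show "?L \<subseteq> ?R" by force
    show "?R \<subseteq> ?L"
    proof
      fix z assume "z \<in> ?R"
      then obtain i where "z = ((x # y # xs) ! i, (x # y # xs) ! Suc i)" "Suc i < length (x # y # xs)"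
        by blast
      then show "z \<in> ?L" by (cases i) auto
    qed
  qed
  with 3 show ?case by simp
qed auto

text \<open>
  Injectivity allows the two iterations to be undone step by step; a point outside the range
  of \<open>g\<close> has no predecessor, so both iterations must be exhausted at the same time. With
  \<open>x = y\<close> this says that an orbit has no repetition, with \<open>x \<noteq> y\<close> that orbits are disjoint.
\<close>

lemma orbits_from_outside_range_disjoint:
  assumes inj: "inj_on g L" and out: "x \<notin> g ` L" "y \<notin> g ` L"
    and "\<forall>k<i. (g ^^ k) x \<in> L" "\<forall>k<j. (g ^^ k) y \<in> L" "(g ^^ i) x = (g ^^ j) y"
  shows "i = j \<and> x = y"
  using assms(4-)
proof (induction i arbitrary: j)
  case 0
  then show ?case using out(1) by (cases j) auto
next
  case (Suc i)
  show ?case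
  proof (cases j)
    case 0
    with Suc.prems out(2) show ?thesis by auto
  next
    case (Suc j')
    have "(g ^^ i) x = (g ^^ j') y"
      using inj Suc.prems Suc by (auto dest!: inj_onD)
    with Suc.IH[of j'] Suc.prems Suc show ?thesis by auto
  qed
qed

text \<open>
  The path starting at \<open>x \<in> X\<close> is the orbit of \<open>x\<close> under \<open>g\<close>. It cannot run forever in the
  finite set \<open>verts D - B\<close> because it does not repeat a vertex, so it reaches \<open>B\<close>.
\<close>

lemma step_map_imp_linked:
  assumes fin: "finite (verts D)" and X: "X \<subseteq> verts D"
    and g: "step_map (arcs_ends D) (verts D) B g"
    and avoid: "g ` (verts D - B) \<inter> X = {}"
    and wf: "arcs_ends D \<subseteq> verts D \<times> verts D"
  shows "linked D X B"
proof -
  let ?L = "verts D - B"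
  have inj: "inj_on g ?L" using g by (simp add: step_map_def)
  have out: "x \<notin> g ` ?L" if "x \<in> X" for x using that avoid by blast
  have stay: "(g ^^ k) x \<in> verts D" if "x \<in> X" "\<forall>l<k. (g ^^ l) x \<in> ?L" for x k
    using that(2)
  proof (induction k)
    case (Suc k)
    then have "(g ^^ k) x \<in> ?L" by blast
    from step_map_closed[OF g wf this] show ?case by simp
  qed (use that X in auto)
  have reach: "\<exists>n. (g ^^ n) x \<in> B" if "x \<in> X" for x
  proof (rule ccontr)
    assume none: "\<not> (\<exists>n. (g ^^ n) x \<in> B)"
    have all: "(g ^^ k) x \<in> ?L" for k
    proof (induction k rule: less_induct)
      case (less k)
      then show ?case using stay[OF that, of k] none by blast
    qed
    have "inj (\<lambda>k. (g ^^ k) x)"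
      by (rule injI) (use orbits_from_outside_range_disjoint[OF inj out[OF that] out[OF that]] all in blast)
    then have "infinite (range (\<lambda>k. (g ^^ k) x))" by (simp add: finite_image_iff)
    then show False using fin finite_subset[of "range (\<lambda>k. (g ^^ k) x)" "verts D"] all by blast
  qed
  define n where "n x = (LEAST n. (g ^^ n) x \<in> B)" for x
  define P where "P x = map (\<lambda>k. (g ^^ k) x) [0..<Suc (n x)]" for x
  have end_B: "(g ^^ n x) x \<in> B" if "x \<in> X" for x
    using reach[OF that] unfolding n_def by (rule LeastI_ex)
  have before: "(g ^^ k) x \<in> ?L" if "x \<in> X" "k < n x" for x k
    using that(2)
  proof (induction k rule: less_induct)
    case (less k)
    moreover have "(g ^^ k) x \<notin> B" using less.prems not_less_Least unfolding n_def by blast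
    ultimately show ?case using stay[OF that(1), of k] by auto
  qed
  have disj: "k = l \<and> x = y"
    if "x \<in> X" "y \<in> X" "k \<le> n x" "l \<le> n y" "(g ^^ k) x = (g ^^ l) y" for x y k l
    by (rule orbits_from_outside_range_disjoint[OF inj out out])
      (use that before in auto)
  have path: "vpath (P x) D" if x: "x \<in> X" for x
  proof -
    have "distinct (P x)"
    proof -
      have "inj_on (\<lambda>k. (g ^^ k) x) {0..<Suc (n x)}"
        by (rule inj_onI) (use disj[OF x x] in auto)
      then show ?thesis unfolding P_def distinct_map by (simp del: upt_Suc)
    qed
    moreover have "set (P x) \<subseteq> verts D"
      using stay[OF x] before[OF x] by (auto simp: P_def simp del: upt_Suc)
    moreover have "((g ^^ i) x, (g ^^ Suc i) x) \<in> arcs_ends D" if "i < n x" for i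
    proof -
      have "g ((g ^^ i) x) \<noteq> (g ^^ i) x" using disj[OF x x, of "Suc i" i] that by auto
      then show ?thesis using step_mapD[OF g, of "(g ^^ i) x"] before[OF x that] by auto
    qed
    then have "set (vwalk_arcs (P x)) \<subseteq> arcs_ends D"
      unfolding vwalk_arcs_conv_nth by (auto simp: P_def simp del: upt_Suc)
    ultimately show ?thesis by (simp add: vpath_def vwalk_def P_def)
  qed
  show ?thesis
    unfolding linked_def
  proof (rule exI[of _ P], intro conjI ballI impI)
    fix x assume x: "x \<in> X"
    show "vpath (P x) D" by (rule path[OF x])
    show "hd (P x) = x" by (simp add: P_def hd_map del: upt_Suc)
    show "last (P x) \<in> B" using end_B[OF x] by (simp add: P_def)
  next
    fix x y assume "x \<in> X" "y \<in> X" "x \<noteq> y"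
    then show "set (P x) \<inter> set (P y) = {}"
      using disj[of x y] by (fastforce simp: P_def simp del: upt_Suc)
  qed
qed

text \<open>
  A vertex outside \<open>B\<close> is never the end of a path, so the successor along its path is defined.
  The starting vertex of a path is neither fixed nor the successor of another vertex, whence the
  range of \<open>g\<close> avoids \<open>X\<close>.
\<close>

lemma linked_imp_step_map:
  assumes "linked D X B"
  shows "\<exists>g. step_map (arcs_ends D) (verts D) B g \<and> g ` (verts D - B) \<inter> X = {}"
proof -
  obtain P where path: "\<And>x. x \<in> X \<Longrightarrow> vpath (P x) D"
    and hd: "\<And>x. x \<in> X \<Longrightarrow> hd (P x) = x" and last: "\<And>x. x \<in> X \<Longrightarrow> last (P x) \<in> B"
    and disj: "\<And>x y. x \<in> X \<Longrightarrow> y \<in> X \<Longrightarrow> x \<noteq> y \<Longrightarrow> set (P x) \<inter> set (P y) = {}"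
    using assms unfolding linked_def by blast
  have ne: "P x \<noteq> []" and dist: "distinct (P x)" if "x \<in> X" for x
    using path[OF that] by (auto simp: vpath_def vwalk_def)
  define S where "S v w \<longleftrightarrow> (\<exists>x\<in>X. \<exists>i. Suc i < length (P x) \<and> v = P x ! i \<and> w = P x ! Suc i)" for v w
  define on where "on v \<longleftrightarrow> (\<exists>x\<in>X. v \<in> set (P x))" for v
  have same: "x = y \<and> i = j"
    if "x \<in> X" "y \<in> X" "i < length (P x)" "j < length (P y)" "P x ! i = P y ! j" for x y i j
  proof -
    have "x = y"
    proof (rule ccontr)
      assume "x \<noteq> y"
      from disj[OF that(1,2) this] that(3-5) show False by (metis disjoint_iff nth_mem)
    qed
    then show ?thesis using that dist nth_eq_iff_index_eq by blast
  qed
  have S_on: "on v" "on w" if "S v w" for v w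
    using that Suc_lessD unfolding S_def on_def by (metis nth_mem)+
  have S_unique: "w = w'" if "S v w" "S v w'" for v w w'
  proof -
    from that obtain x i y j where "x \<in> X" "Suc i < length (P x)" "v = P x ! i" "w = P x ! Suc i"
      "y \<in> X" "Suc j < length (P y)" "v = P y ! j" "w' = P y ! Suc j" unfolding S_def by blast
    then show ?thesis using same[of x y i j] by auto
  qed
  have S_inj: "v = v'" if "S v w" "S v' w" for v v' w
  proof -
    from that obtain x i y j where "x \<in> X" "Suc i < length (P x)" "v = P x ! i" "w = P x ! Suc i"
      "y \<in> X" "Suc j < length (P y)" "v' = P y ! j" "w = P y ! Suc j" unfolding S_def by blast
    then show ?thesis using same[of x y "Suc i" "Suc j"] by auto
  qed
  have S_ex: "\<exists>w. S v w" if "on v" "v \<notin> B" for v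
  proof -
    from that(1) obtain x i where x: "x \<in> X" "i < length (P x)" "v = P x ! i"
      unfolding on_def by (metis in_set_conv_nth)
    have "Suc i \<noteq> length (P x)"
      using last[OF x(1)] that(2) x last_conv_nth[OF ne[OF x(1)]] by (metis diff_Suc_1)
    with x show ?thesis unfolding S_def by (metis Suc_lessI)
  qed
  have S_arc: "(v, w) \<in> arcs_ends D" if "S v w" for v w
    using that path unfolding S_def vpath_def vwalk_def vwalk_arcs_conv_nth by blast
  have S_start: "w \<notin> X" if "S v w" for v w
  proof
    assume w: "w \<in> X"
    from that obtain x i where x: "x \<in> X" "Suc i < length (P x)" "w = P x ! Suc i"
      unfolding S_def by blast
    have "w = P w ! 0" using hd[OF w] ne[OF w] by (simp add: hd_conv_nth)
    then have "P x ! Suc i = P w ! 0" using x(3) by simp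
    from same[OF x(1) w x(2) _ this] ne[OF w] show False by simp
  qed
  define g where "g v = (if on v then SOME w. S v w else v)" for v
  have gS: "S v (g v)" if "on v" "v \<notin> B" for v
    using someI_ex[OF S_ex[OF that]] that by (simp add: g_def)
  have goff: "g v = v" if "\<not> on v" for v using that by (simp add: g_def)
  have Xon: "on x" if "x \<in> X" for x
    using that hd[OF that] ne[OF that] unfolding on_def by (metis hd_in_set)
  have "inj_on g (verts D - B)"
    by (rule inj_onI) (metis DiffD2 S_inj S_on(2) gS goff)
  moreover have "g v \<notin> X" if "v \<notin> B" for v
    using S_start gS[OF _ that] goff Xon by metis
  ultimately show ?thesis
    unfolding step_map_def using gS goff S_arc by blast
qed

lemma linked_iff_step_map:
  assumes "fin_digraph D" "X \<subseteq> verts D"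
  shows "linked D X B \<longleftrightarrow>
    (\<exists>g. step_map (arcs_ends D) (verts D) B g \<and> g ` (verts D - B) \<inter> X = {})"
proof -
  interpret fin_digraph D by fact
  have "arcs_ends D \<subseteq> verts D \<times> verts D" by (auto simp: arcs_ends_conv)
  from step_map_imp_linked[OF finite_verts assms(2) _ _ this] linked_imp_step_map
  show ?thesis by metis
qed

lemma step_map_image:
  assumes inj: "inj_on f V" and B: "B \<subseteq> V" and X: "X \<subseteq> V" and R: "R \<subseteq> V \<times> V"
    and g: "step_map R V B g" "g ` (V - B) \<inter> X = {}"
  shows "\<exists>h. step_map (map_prod f f ` R) (f ` V) (f ` B) h \<and> h ` (f ` V - f ` B) \<inter> f ` X = {}"
proof -
  define i where "i = inv_into V f"
  have i: "i (f v) = v" if "v \<in> V" for v using that inj by (simp add: i_def)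
  have L: "f ` V - f ` B = f ` (V - B)" using inj B by (simp add: inj_on_image_set_diff)
  have gV: "g v \<in> V" if "v \<in> V - B" for v using step_map_closed[OF g(1) R that] .
  have "step_map (map_prod f f ` R) (f ` V) (f ` B) (f \<circ> g \<circ> i)"
    unfolding step_map_def L
  proof (intro conjI ballI)
    show "inj_on (f \<circ> g \<circ> i) (f ` (V - B))"
    proof (intro comp_inj_on)
      show "inj_on i (f ` (V - B))"
        unfolding i_def by (rule inj_on_inv_into) blast
      have iL: "i ` f ` (V - B) = V - B"
        unfolding i_def by (rule inv_into_image_cancel[OF inj]) blast
      show "inj_on g (i ` f ` (V - B))"
        unfolding iL using g(1) by (simp add: step_map_def)
      show "inj_on f (g ` i ` f ` (V - B))"
        unfolding iL by (rule inj_on_subset[OF inj]) (use gV in blast)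
    qed
    fix w assume "w \<in> f ` (V - B)"
    then obtain v where v: "v \<in> V - B" "w = f v" by blast
    then have "g v = v \<or> (v, g v) \<in> R" using step_mapD[OF g(1)] by blast
    then show "(f \<circ> g \<circ> i) w = w \<or> (w, (f \<circ> g \<circ> i) w) \<in> map_prod f f ` R"
      using v by (auto simp: i intro!: rev_image_eqI)
  qed
  moreover have "(f \<circ> g \<circ> i) w \<notin> f ` X" if w: "w \<in> f ` (V - B)" for w
  proof
    assume a: "(f \<circ> g \<circ> i) w \<in> f ` X"
    obtain v where v: "v \<in> V - B" "w = f v" using w by blast
    then have "g v \<in> X" using a gV[OF v(1)] X inj by (auto simp: i inj_on_image_mem_iff)
    then show False using g(2) v by blast
  qed
  ultimately show ?thesis unfolding L by blast
qed

text \<open>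
  Gammoids are defined with digraphs on natural numbers; since only finitely many vertices
  matter, a digraph over any type of vertices serves as well.
\<close>

lemma gammoid_if_step_maps:
  fixes V :: "'v set" and \<phi> :: "'a \<Rightarrow> 'v"
  assumes M: "matroid M" and V: "finite V" "B \<subseteq> V" "R \<subseteq> V \<times> V"
    and \<phi>: "inj_on \<phi> (ground M)" "\<phi> ` ground M \<subseteq> V"
    and ind: "\<And>X. X \<subseteq> ground M \<Longrightarrow>
      indep M X \<longleftrightarrow> (\<exists>g. step_map R V B g \<and> g ` (V - B) \<inter> \<phi> ` X = {})"
  shows "gammoid M"
proof -
  obtain f :: "'v \<Rightarrow> nat" where f: "inj_on f V"
    using finite_imp_inj_to_nat_seg[OF V(1)] by blast
  let ?RR = "map_prod f f ` R"
  define D :: "(nat, nat) pre_digraph" where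
    "D = \<lparr>verts = f ` V, arcs = prod_encode ` ?RR,
      tail = fst \<circ> prod_decode, head = snd \<circ> prod_decode\<rparr>"
  have "finite R" using V finite_subset by (metis finite_cartesian_product)
  then have fin: "fin_digraph D"
    by unfold_locales (use V in \<open>auto simp: D_def\<close>)
  have ends: "arcs_ends D = ?RR" and verts: "verts D = f ` V"
    by (force simp: D_def arcs_ends_conv)+
  have "indep M X \<longleftrightarrow> linked D ((f \<circ> \<phi>) ` X) (f ` B)" if X: "X \<subseteq> ground M" for X
  proof -
    have XV: "\<phi> ` X \<subseteq> V" using X \<phi>(2) by blast
    have "linked D ((f \<circ> \<phi>) ` X) (f ` B) \<longleftrightarrow>
        (\<exists>h. step_map ?RR (f ` V) (f ` B) h \<and> h ` (f ` V - f ` B) \<inter> f ` \<phi> ` X = {})"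
      unfolding image_comp[symmetric] ends[symmetric] verts[symmetric]
      by (rule linked_iff_step_map[OF fin]) (use XV in \<open>auto simp: verts\<close>)
    also have "\<dots> \<longleftrightarrow> (\<exists>g. step_map R V B g \<and> g ` (V - B) \<inter> \<phi> ` X = {})"
    proof
      assume "\<exists>g. step_map R V B g \<and> g ` (V - B) \<inter> \<phi> ` X = {}"
      then show "\<exists>h. step_map ?RR (f ` V) (f ` B) h \<and> h ` (f ` V - f ` B) \<inter> f ` \<phi> ` X = {}"
        using step_map_image[OF f V(2) XV V(3)] by blast
    next
      let ?i = "inv_into V f"
      have i: "?i ` f ` Y = Y" if "Y \<subseteq> V" for Y
        using that f by (simp add: inv_into_image_cancel)
      have iR: "map_prod ?i ?i ` ?RR = R"
      proof -
        have "map_prod ?i ?i (map_prod f f r) = r" if "r \<in> R" for r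
          using that V(3) f by (cases r) auto
        then show ?thesis by (simp add: image_image)
      qed
      assume "\<exists>h. step_map ?RR (f ` V) (f ` B) h \<and> h ` (f ` V - f ` B) \<inter> f ` \<phi> ` X = {}"
      then obtain h where h: "step_map ?RR (f ` V) (f ` B) h" "h ` (f ` V - f ` B) \<inter> f ` \<phi> ` X = {}"
        by blast
      have "?RR \<subseteq> f ` V \<times> f ` V" using V(3) by auto
      from step_map_image[OF inj_on_inv_into[OF subset_refl] image_mono[OF V(2)] image_mono[OF XV] this h]
      show "\<exists>g. step_map R V B g \<and> g ` (V - B) \<inter> \<phi> ` X = {}"
        by (simp add: i V(2) XV iR)
    qed
    finally show ?thesis using ind[OF X] by blast
  qed
  moreover have "inj_on (f \<circ> \<phi>) (ground M)" using \<phi> f by (metis comp_inj_on inj_on_subset)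
  moreover have "f ` B \<subseteq> verts D" "(f \<circ> \<phi>) ` ground M \<subseteq> verts D" using V \<phi> by (auto simp: verts)
  ultimately show ?thesis unfolding gammoid_def using M fin by blast
qed

section \<open>Gammoids are base orderable\<close>

text \<open>
  The edges \<open>{g1 v, g2 v}\<close> form a graph on the values in which each component is a path or a
  cycle. A value \<open>x\<close> of \<open>g2\<close> only is the end of a path, whose other end \<open>\<sigma> x\<close> is a value of
  \<open>g1\<close> only; \<open>K\<close> is the set of arguments on this path. Switching between the two maps on \<open>K\<close>
  exchanges \<open>\<sigma> x\<close> and \<open>x\<close> in the ranges.
\<close>

lemma alternating_path_exchange:
  fixes g1 g2 :: "'l \<Rightarrow> 'v"
  assumes fin: "finite L" and inj: "inj_on g1 L" "inj_on g2 L"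
  shows "\<exists>\<sigma>. inj_on \<sigma> (g2 ` L - g1 ` L) \<and>
    (\<forall>x\<in>g2 ` L - g1 ` L. \<sigma> x \<in> g1 ` L - g2 ` L \<and>
      (\<exists>K\<subseteq>L. g1 ` K - {\<sigma> x} = g2 ` K - {x} \<and> \<sigma> x \<in> g1 ` K \<and> x \<in> g2 ` K))"
proof -
  define R where "R = (\<lambda>v. (g2 v, g1 v)) ` L"
  have R_inj: "single_valued R" "single_valued (R\<inverse>)"
    using inj unfolding single_valued_def R_def inj_on_def by auto
  have R_dom: "Domain R = g2 ` L" and R_ran: "Range R = g1 ` L"
    by (force simp: R_def)+
  define e where "e x y \<longleftrightarrow> (x, y) \<in> R\<^sup>* \<and> y \<notin> g2 ` L" for x y
  have stuck: "z = y" if "(y, z) \<in> R\<^sup>*" "y \<notin> g2 ` L" for y z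
    using that R_dom by (metis Domain.DomainI converse_rtranclE)
  have start: "z = x" if "(z, x) \<in> R\<^sup>*" "x \<notin> g1 ` L" for z x
    using that R_ran by (metis Range.RangeI rtranclE)
  \<comment> \<open>If the path from \<open>x\<close> never stopped, \<open>R\<close> would map the finite set of its points injectively into that set without \<open>x\<close>.\<close>
  have ex: "\<exists>y. e x y" if x: "x \<in> g2 ` L - g1 ` L" for x
  proof (rule ccontr)
    assume none: "\<nexists>y. e x y"
    define C where "C = R\<^sup>* `` {x}"
    define K where "K = {v \<in> L. g2 v \<in> C}"
    have "C \<subseteq> g2 ` L" using none by (auto simp: e_def C_def)
    then have g2K: "g2 ` K = C" by (auto simp: K_def)
    have "g1 ` K \<subseteq> C - {x}"
    proof
      fix w assume "w \<in> g1 ` K"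
      then obtain v where v: "v \<in> L" "(x, g2 v) \<in> R\<^sup>*" "w = g1 v"
        by (auto simp: K_def C_def)
      then have "(g2 v, w) \<in> R" by (auto simp: R_def)
      with v(2) have "(x, w) \<in> R\<^sup>*" by (rule rtrancl_into_rtrancl)
      moreover have "w \<noteq> x" using x v(1,3) by blast
      ultimately show "w \<in> C - {x}" by (simp add: C_def)
    qed
    moreover have "x \<in> C" by (simp add: C_def)
    ultimately have "g1 ` K \<subset> g2 ` K" unfolding g2K by blast
    then have "card (g1 ` K) < card (g2 ` K)"
      using fin by (intro psubset_card_mono) (auto simp: K_def)
    moreover have "card (g1 ` K) = card K" "card (g2 ` K) = card K"
      using inj by (auto intro!: card_image intro: inj_on_subset simp: K_def)
    ultimately show False by simp
  qed
  have unique: "y = z" if "e x y" "e x z" for x y z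
    using single_valued_confluent[OF R_inj(1), of x y z] that stuck unfolding e_def by metis
  define \<sigma> where "\<sigma> x = (SOME y. e x y)" for x
  have \<sigma>: "e x (\<sigma> x)" if "x \<in> g2 ` L - g1 ` L" for x
    using someI_ex[OF ex[OF that]] by (simp add: \<sigma>_def)
  have "inj_on \<sigma> (g2 ` L - g1 ` L)"
  proof (rule inj_onI)
    fix x x' assume x: "x \<in> g2 ` L - g1 ` L" "x' \<in> g2 ` L - g1 ` L" "\<sigma> x = \<sigma> x'"
    then have "(\<sigma> x, x) \<in> (R\<inverse>)\<^sup>*" "(\<sigma> x, x') \<in> (R\<inverse>)\<^sup>*"
      using \<sigma>[of x] \<sigma>[of x'] by (auto simp: e_def rtrancl_converse)
    from single_valued_confluent[OF R_inj(2) this] have "(x', x) \<in> R\<^sup>* \<or> (x, x') \<in> R\<^sup>*"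
      by (auto simp: rtrancl_converse)
    then show "x = x'" using start[of x' x] start[of x x'] x(1,2) by (metis DiffD2)
  qed
  moreover have "\<sigma> x \<in> g1 ` L - g2 ` L \<and>
    (\<exists>K\<subseteq>L. g1 ` K - {\<sigma> x} = g2 ` K - {x} \<and> \<sigma> x \<in> g1 ` K \<and> x \<in> g2 ` K)"
    if x: "x \<in> g2 ` L - g1 ` L" for x
  proof -
    let ?y = "\<sigma> x"
    define C where "C = R\<^sup>* `` {x}"
    define K where "K = {v \<in> L. g2 v \<in> C}"
    have y: "(x, ?y) \<in> R\<^sup>*" "?y \<notin> g2 ` L" using \<sigma>[OF x] by (auto simp: e_def)
    have "g2 ` K = C - {?y}"
    proof
      have "g2 ` K \<subseteq> C" "g2 ` K \<subseteq> g2 ` L" by (auto simp: K_def)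
      then show "g2 ` K \<subseteq> C - {?y}" using y(2) by blast
      show "C - {?y} \<subseteq> g2 ` K"
      proof
        fix z assume z: "z \<in> C - {?y}"
        then have "\<not> e x z" using unique[OF \<sigma>[OF x]] by blast
        then show "z \<in> g2 ` K" using z by (auto simp: e_def K_def C_def)
      qed
    qed
    moreover have "g1 ` K = C - {x}"
    proof
      show "g1 ` K \<subseteq> C - {x}"
      proof
        fix w assume "w \<in> g1 ` K"
        then obtain v where v: "v \<in> L" "(x, g2 v) \<in> R\<^sup>*" "w = g1 v"
          by (auto simp: K_def C_def)
        then have "(g2 v, w) \<in> R" by (auto simp: R_def)
        with v(2) have "(x, w) \<in> R\<^sup>*" by (rule rtrancl_into_rtrancl)
        moreover have "w \<noteq> x" using x v(1,3) by blast
      ultimately show "w \<in> C - {x}" by (simp add: C_def)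
      qed
      show "C - {x} \<subseteq> g1 ` K"
      proof
        fix w assume "w \<in> C - {x}"
        then have "(x, w) \<in> R\<^sup>*" "x \<noteq> w" by (auto simp: C_def)
        then obtain u where "(x, u) \<in> R\<^sup>*" "(u, w) \<in> R" by (metis rtranclE)
        then show "w \<in> g1 ` K" by (auto simp: R_def K_def C_def)
      qed
    qed
    moreover have "?y \<noteq> x" using x y by auto
    moreover have "?y \<in> g1 ` L"
      using y(1) \<open>?y \<noteq> x\<close> R_ran by (metis Range.RangeI rtranclE)
    ultimately have "?y \<in> g1 ` L - g2 ` L" "g1 ` K - {?y} = g2 ` K - {x}"
      "?y \<in> g1 ` K" "x \<in> g2 ` K" "K \<subseteq> L"
      using y by (auto simp: K_def C_def)
    then show ?thesis by blast
  qed
  ultimately show ?thesis by blast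
qed

lemma switch_injection:
  assumes "inj_on g L" "inj_on h L" "K \<subseteq> L" "h ` K \<subseteq> insert x (g ` K)" "x \<notin> g ` L"
  shows "inj_on (\<lambda>v. if v \<in> K then h v else g v) L"
proof (rule inj_onI)
  have clash: "h u \<noteq> g v" if "u \<in> K" "v \<in> L" "v \<notin> K" for u v
  proof
    assume eq: "h u = g v"
    then have "g v \<in> insert x (g ` K)" using that assms(4) by (metis image_eqI subset_iff)
    moreover have "g v \<noteq> x" using that(2) assms(5) by blast
    ultimately obtain w where "w \<in> K" "g v = g w" by blast
    then show False using that assms(1,3) by (metis inj_onD subset_iff)
  qed
  fix u v
  assume "u \<in> L" "v \<in> L" "(if u \<in> K then h u else g u) = (if v \<in> K then h v else g v)"
  then show "u = v"
    using clash[of u v] clash[of v u] assms(1,2)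
    by (cases "u \<in> K"; cases "v \<in> K") (auto dest: inj_onD)
qed

lemma step_map_switch:
  assumes g: "step_map R V B g" "step_map R V B h"
    and K: "K \<subseteq> V - B" "g ` K - {y} = h ` K - {x}" "y \<in> g ` K" "x \<in> h ` K"
    and xy: "x \<notin> g ` (V - B)" "y \<notin> h ` (V - B)"
  shows "\<exists>k. step_map R V B k \<and> k ` (V - B) = insert x (g ` (V - B)) - {y}"
proof -
  let ?L = "V - B" and ?k = "\<lambda>v. if v \<in> K then h v else g v"
  have "inj_on ?k ?L"
    using g K xy by (intro switch_injection[of _ _ _ _ x]) (auto simp: step_map_def)
  then have "step_map R V B ?k" using g by (auto simp: step_map_def)
  moreover have "?k ` ?L = insert x (g ` ?L) - {y}"
  proof -
    have "?k ` ?L = h ` K \<union> g ` (?L - K)" using K(1) by auto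
    also have "g ` (?L - K) = g ` ?L - g ` K"
      using g(1) K(1) inj_on_image_set_diff[of g ?L ?L K] by (auto simp: step_map_def)
    also have "h ` K = insert x (g ` K - {y})" using K(2,4) by (metis insert_Diff)
    finally have img: "?k ` ?L = insert x (g ` K - {y}) \<union> (g ` ?L - g ` K)" .
    have "insert x (S - {y}) \<union> (U - S) = insert x U - {y}"
      if "y \<in> S" "S \<subseteq> U" "x \<noteq> y" for S U
      using that by blast
    moreover have "x \<noteq> y" using xy(2) K(1,4) by (metis image_mono subsetD)
    ultimately show ?thesis unfolding img using K(3) image_mono[OF K(1)] by metis
  qed
  ultimately show ?thesis by (intro exI[of _ ?k] conjI)
qed

lemma disjoint_after_exchange:
  assumes "H \<inter> P = {}" "t \<notin> P"
  shows "(insert t H - {u}) \<inter> insert u P = {}"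
  using assms by blast

text \<open>
  The last hypothesis says that \<open>Y\<close> spans \<open>X\<close>; for two bases this is the usual base
  orderability. The injection between values of maps avoiding \<open>Y\<close> and \<open>X\<close> restricts to
  \<open>X - Y\<close>: if the partner of \<open>x\<close> were not in \<open>Y\<close>, the switched map would avoid
  \<open>insert x Y\<close>, which is dependent.
\<close>

lemma gammoid_symmetric_exchange:
  assumes gam: "gammoid M" and ind: "indep M X" "indep M Y"
    and span: "\<And>x. x \<in> X - Y \<Longrightarrow> \<not> indep M (insert x Y)"
  shows "\<exists>\<sigma>. inj_on \<sigma> (X - Y) \<and> (\<forall>x\<in>X - Y. \<sigma> x \<in> Y - X \<and>
    indep M (insert (\<sigma> x) (X - {x})) \<and> indep M (insert x (Y - {\<sigma> x})))"
proof -
  obtain D :: "(nat, nat) pre_digraph" and B \<phi> where M: "matroid M"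
    and D: "fin_digraph D" "B \<subseteq> verts D"
    and \<phi>: "inj_on \<phi> (ground M)" "\<phi> ` ground M \<subseteq> verts D"
    and linked: "\<And>Z. Z \<subseteq> ground M \<Longrightarrow> indep M Z \<longleftrightarrow> linked D (\<phi> ` Z) B"
    using gam unfolding gammoid_def by blast
  let ?E = "ground M" and ?L = "verts D - B" and ?S = "step_map (arcs_ends D) (verts D) B"
  have ind_iff: "indep M Z \<longleftrightarrow> (\<exists>g. ?S g \<and> g ` ?L \<inter> \<phi> ` Z = {})" if "Z \<subseteq> ?E" for Z
    using linked[OF that] linked_iff_step_map[OF D(1), of "\<phi> ` Z" B] \<phi>(2) that
    by (metis image_mono order_trans)
  have X: "X \<subseteq> ?E" and Y: "Y \<subseteq> ?E" using ind M matroid.indep_subset_ground by blast+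
  obtain g h where g: "?S g" "g ` ?L \<inter> \<phi> ` X = {}" and h: "?S h" "h ` ?L \<inter> \<phi> ` Y = {}"
    using ind ind_iff[OF X] ind_iff[OF Y] by metis
  have "finite ?L" using D(1) by (simp add: fin_digraph.finite_verts)
  from alternating_path_exchange[OF this, of g h] g(1) h(1)
  have "\<exists>\<tau>. inj_on \<tau> (h ` ?L - g ` ?L) \<and> (\<forall>z\<in>h ` ?L - g ` ?L. \<tau> z \<in> g ` ?L - h ` ?L \<and>
      (\<exists>K\<subseteq>?L. g ` K - {\<tau> z} = h ` K - {z} \<and> \<tau> z \<in> g ` K \<and> z \<in> h ` K))"
    by (simp add: step_map_def)
  then obtain \<tau> where \<tau>0: "inj_on \<tau> (h ` ?L - g ` ?L) \<and>
    (\<forall>z\<in>h ` ?L - g ` ?L. \<tau> z \<in> g ` ?L - h ` ?L \<and>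
      (\<exists>K\<subseteq>?L. g ` K - {\<tau> z} = h ` K - {z} \<and> \<tau> z \<in> g ` K \<and> z \<in> h ` K))"
    by (rule exE)
  note inj = \<tau>0[THEN conjunct1] and \<tau> = \<tau>0[THEN conjunct2, THEN bspec]
  define \<sigma> where "\<sigma> x = inv_into ?E \<phi> (\<tau> (\<phi> x))" for x
  have main: "\<phi> x \<in> h ` ?L - g ` ?L \<and> \<sigma> x \<in> Y - X \<and> \<phi> (\<sigma> x) = \<tau> (\<phi> x) \<and>
    indep M (insert (\<sigma> x) (X - {x})) \<and> indep M (insert x (Y - {\<sigma> x}))"
    if x: "x \<in> X - Y" for x
  proof -
    have xE: "insert x Y \<subseteq> ?E" using x X Y by blast
    have "\<phi> x \<in> h ` ?L"
    proof (rule ccontr)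
      assume "\<phi> x \<notin> h ` ?L"
      then have "h ` ?L \<inter> \<phi> ` insert x Y = {}" using h(2) by simp
      then show False using span[OF x] ind_iff[OF xE] h(1) by metis
    qed
    moreover have "\<phi> x \<notin> g ` ?L" using g(2) x by (metis DiffD1 disjoint_iff image_eqI)
    ultimately have px: "\<phi> x \<in> h ` ?L - g ` ?L" by blast
    obtain K where K: "K \<subseteq> ?L" "g ` K - {\<tau> (\<phi> x)} = h ` K - {\<phi> x}"
      "\<tau> (\<phi> x) \<in> g ` K" "\<phi> x \<in> h ` K" and t: "\<tau> (\<phi> x) \<in> g ` ?L - h ` ?L"
      using \<tau>[OF px] by metis
    obtain g' where g': "?S g'" "g' ` ?L = insert (\<phi> x) (g ` ?L) - {\<tau> (\<phi> x)}"
      using step_map_switch[OF g(1) h(1) K] px t by (metis DiffD2)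
    obtain h' where h': "?S h'" "h' ` ?L = insert (\<tau> (\<phi> x)) (h ` ?L) - {\<phi> x}"
      using step_map_switch[OF h(1) g(1) K(1) K(2)[symmetric] K(4,3)] px t by (metis DiffD2)
    have "\<tau> (\<phi> x) \<in> \<phi> ` Y"
    proof (rule ccontr)
      assume "\<tau> (\<phi> x) \<notin> \<phi> ` Y"
      then have "h' ` ?L \<inter> \<phi> ` insert x Y = {}"
        unfolding h'(2) image_insert by (rule disjoint_after_exchange[OF h(2)])
      then show False using span[OF x] ind_iff[OF xE] h'(1) by metis
    qed
    then obtain y where y: "y \<in> Y" "\<phi> y = \<tau> (\<phi> x)" by force
    have \<sigma>y: "\<sigma> x = y" using y Y \<phi>(1) unfolding \<sigma>_def by (metis inv_into_f_f subset_iff)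
    have "y \<notin> X" using g(2) t y by (metis DiffD1 disjoint_iff image_eqI)
    have sep: "\<phi> u \<noteq> \<phi> v" if "u \<in> ?E" "v \<in> ?E" "u \<noteq> v" for u v
      using that \<phi>(1) by (meson inj_onD)
    have "g' ` ?L \<inter> \<phi> ` insert y (X - {x}) = {}"
      unfolding g'(2) image_insert y(2)[symmetric]
    proof (rule disjoint_after_exchange)
      show "g ` ?L \<inter> \<phi> ` (X - {x}) = {}" using g(2) by (auto simp: disjoint_iff)
      show "\<phi> x \<notin> \<phi> ` (X - {x})" using sep X x by (auto simp: subset_iff)
    qed
    then have i1: "indep M (insert y (X - {x}))"
      using ind_iff[of "insert y (X - {x})"] g'(1) X Y y(1)
      by (metis Diff_subset insert_subset subset_iff)
    have "h' ` ?L \<inter> \<phi> ` insert x (Y - {y}) = {}"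
      unfolding h'(2) image_insert y(2)[symmetric]
    proof (rule disjoint_after_exchange)
      show "h ` ?L \<inter> \<phi> ` (Y - {y}) = {}" using h(2) by (auto simp: disjoint_iff)
      show "\<phi> y \<notin> \<phi> ` (Y - {y})" using sep Y y(1) by (auto simp: subset_iff)
    qed
    then have i2: "indep M (insert x (Y - {y}))"
      using ind_iff[of "insert x (Y - {y})"] h'(1) X Y x
      by (metis Diff_subset DiffD1 insert_subset subset_iff)
    show ?thesis using px y \<open>y \<notin> X\<close> i1 i2 unfolding \<sigma>y by simp
  qed
  have "inj_on \<sigma> (X - Y)"
  proof (rule inj_onI)
    fix x x' assume x: "x \<in> X - Y" "x' \<in> X - Y" "\<sigma> x = \<sigma> x'"
    then have "\<phi> x = \<phi> x'" using main[OF x(1)] main[OF x(2)] inj by (metis inj_onD)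
    then show "x = x'" using \<phi>(1) x X by (meson DiffD1 inj_onD subset_iff)
  qed
  then show ?thesis using main by blast
qed

section \<open>Binary matroids through fundamental sets\<close>

text \<open>
  Sums over \<open>bit\<close> are easier to handle with the ring operations than after their rewriting
  to bit operations.
\<close>

declare add_bit_eq_xor [simp del] mult_bit_eq_and [simp del]

lemma sum_indicator_bit:
  assumes "finite S"
  shows "(\<Sum>x\<in>S. if P x then 1 else 0 :: bit) = (if odd (card {x\<in>S. P x}) then 1 else 0)"
  using assms
proof (induction S rule: finite_induct)
  case (insert x S)
  have "{y \<in> insert x S. P y} = (if P x then insert x {y\<in>S. P y} else {y\<in>S. P y})" by auto
  then show ?case using insert by (simp add: add_self_bit)
qed simp

text \<open>
  The columns labelled by \<open>B\<close> are a basis of the column space, and \<open>F p\<close> is the fundamental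
  circuit of \<open>p\<close> with respect to \<open>B\<close>, without \<open>p\<close> itself.
\<close>

definition fundamental_family ::
    "nat \<Rightarrow> (nat \<Rightarrow> 'a \<Rightarrow> bit) \<Rightarrow> 'a set \<Rightarrow> 'a set \<Rightarrow> ('a \<Rightarrow> 'a set) \<Rightarrow> bool" where
  "fundamental_family m A E B F \<longleftrightarrow> finite E \<and> B \<subseteq> E \<and> columns_indep m A B \<and>
     (\<forall>p\<in>E - B. F p \<subseteq> B \<and> (\<forall>i<m. A i p = (\<Sum>b\<in>F p. A i b)))"

text \<open>
  Replacing each \<open>p\<close> by the sum over \<open>F p\<close> turns the sum over \<open>Z\<close> into a combination of basis
  columns, all of whose coefficients must vanish.
\<close>

lemma zero_sum_fundamental:
  assumes ff: "fundamental_family m A E B F" and Z: "Z \<subseteq> E"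
  shows "zero_sum m A Z \<longleftrightarrow> (\<forall>b\<in>B. b \<in> Z \<longleftrightarrow> odd (card {p\<in>Z - B. b \<in> F p}))"
proof -
  have fin: "finite Z" "finite B"
    using ff Z finite_subset unfolding fundamental_family_def by metis+
  have F: "F p \<subseteq> B" "\<And>i. i < m \<Longrightarrow> A i p = (\<Sum>b\<in>F p. A i b)" if "p \<in> Z - B" for p
    using ff Z that unfolding fundamental_family_def by (metis DiffD1 DiffD2 DiffI subset_iff)+
  define c :: "'a \<Rightarrow> bit" where
    "c b = (if b \<in> Z then 1 else 0) + (\<Sum>p\<in>Z - B. if b \<in> F p then 1 else 0)" for b
  have "(\<Sum>x\<in>Z. A i x) = (\<Sum>b\<in>B. c b * A i b)" if i: "i < m" for i
  proof -
    have "(\<Sum>x\<in>Z \<inter> B. A i x) = (\<Sum>b\<in>B. (if b \<in> Z then 1 else 0) * A i b)"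
      by (rule sum.mono_neutral_cong_left) (use fin in auto)
    moreover have "(\<Sum>p\<in>Z - B. A i p) = (\<Sum>b\<in>B. (\<Sum>p\<in>Z - B. if b \<in> F p then 1 else 0) * A i b)"
    proof -
      have "(\<Sum>p\<in>Z - B. A i p) = (\<Sum>p\<in>Z - B. \<Sum>b\<in>B. (if b \<in> F p then 1 else 0) * A i b)"
      proof (rule sum.cong[OF refl])
        fix p assume p: "p \<in> Z - B"
        have "(\<Sum>b\<in>F p. A i b) = (\<Sum>b\<in>B. (if b \<in> F p then 1 else 0) * A i b)"
          by (rule sum.mono_neutral_cong_left) (use fin F(1)[OF p] in auto)
        then show "A i p = (\<Sum>b\<in>B. (if b \<in> F p then 1 else 0) * A i b)"
          using F(2)[OF p i] by simp
      qed
      also have "\<dots> = (\<Sum>b\<in>B. \<Sum>p\<in>Z - B. (if b \<in> F p then 1 else 0) * A i b)"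
        by (rule sum.swap)
      finally show ?thesis by (simp add: sum_distrib_right)
    qed
    ultimately show ?thesis
      using sum.Int_Diff[OF fin(1), of "A i" B]
      by (simp add: c_def distrib_right sum.distrib)
  qed
  then have "zero_sum m A Z \<longleftrightarrow> (\<forall>i<m. (\<Sum>b\<in>B. c b * A i b) = 0)"
    unfolding zero_sum_def by simp
  also have "\<dots> \<longleftrightarrow> (\<forall>b\<in>B. c b = 0)"
    using ff unfolding fundamental_family_def columns_indep_def by auto
  also have "\<dots> \<longleftrightarrow> (\<forall>b\<in>B. b \<in> Z \<longleftrightarrow> odd (card {p\<in>Z - B. b \<in> F p}))"
    using fin by (auto simp: c_def sum_indicator_bit add_self_bit)
  finally show ?thesis .
qed

text \<open>
  A zero-sum set is determined by its part \<open>Q\<close> outside the basis, and this part can be completed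
  within \<open>X\<close> as soon as the basis elements that occur an odd number of times lie in \<open>X\<close>.
\<close>

lemma columns_indep_fundamental:
  assumes ff: "fundamental_family m A E B F" and X: "X \<subseteq> E"
  shows "columns_indep m A X \<longleftrightarrow>
    (\<forall>Q\<subseteq>X - B. (\<forall>b\<in>B - X. even (card {p\<in>Q. b \<in> F p})) \<longrightarrow> Q = {})"
proof -
  have fin: "finite X" using ff X finite_subset unfolding fundamental_family_def by metis
  show ?thesis
    unfolding columns_indep_iff[OF fin]
  proof (intro iffI allI impI)
    fix Q
    assume ind: "\<forall>Z\<subseteq>X. zero_sum m A Z \<longrightarrow> Z = {}"
      and Q: "Q \<subseteq> X - B" "\<forall>b\<in>B - X. even (card {p\<in>Q. b \<in> F p})"
    define Z where "Z = Q \<union> {b\<in>B. odd (card {p\<in>Q. b \<in> F p})}"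
    have Q_eq: "Z - B = Q" using Q(1) by (auto simp: Z_def)
    have mem: "b \<in> Z \<longleftrightarrow> odd (card {p\<in>Q. b \<in> F p})" if "b \<in> B" for b
      using that Q(1) by (auto simp: Z_def)
    have ZX: "Z \<subseteq> X" using Q by (auto simp: Z_def)
    then have ZE: "Z \<subseteq> E" using X by (rule subset_trans)
    have "zero_sum m A Z"
      unfolding zero_sum_fundamental[OF ff ZE] Q_eq using mem by simp
    then have "Z = {}" using ind ZX by simp
    then show "Q = {}" by (simp add: Z_def)
  next
    fix Z
    assume q: "\<forall>Q\<subseteq>X - B. (\<forall>b\<in>B - X. even (card {p\<in>Q. b \<in> F p})) \<longrightarrow> Q = {}"
      and Z: "Z \<subseteq> X" "zero_sum m A Z"
    have ZE: "Z \<subseteq> E" using Z(1) X by (rule subset_trans)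
    have mem: "b \<in> Z \<longleftrightarrow> odd (card {p\<in>Z - B. b \<in> F p})" if "b \<in> B" for b
      using Z(2) that unfolding zero_sum_fundamental[OF ff ZE] by simp
    have sub: "Z - B \<subseteq> X - B" using Z(1) by auto
    have "\<forall>b\<in>B - X. even (card {p\<in>Z - B. b \<in> F p})" using mem Z(1) by auto
    then have none: "Z - B = {}" using q sub by metis
    have "b \<notin> Z" if "b \<in> B" for b using mem[OF that] unfolding none by simp
    then show "Z = {}" using none by auto
  qed
qed

lemma fundamental_family_exists:
  fixes A :: "nat \<Rightarrow> 'a \<Rightarrow> bit"
  assumes fin: "finite E" and B: "B \<subseteq> E" "columns_indep m A B"
    and max: "\<And>p. p \<in> E - B \<Longrightarrow> \<not> columns_indep m A (insert p B)"
  shows "\<exists>F. fundamental_family m A E B F"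
proof -
  have finB: "finite B" using B(1) fin by (rule finite_subset)
  have "\<exists>C\<subseteq>B. \<forall>i<m. A i p = (\<Sum>b\<in>C. A i b)" if p: "p \<in> E - B" for p
  proof -
    obtain Z where Z: "Z \<subseteq> insert p B" "zero_sum m A Z" "Z \<noteq> {}"
      using max[OF p] columns_indep_iff[of "insert p B" m A] finB by auto
    have "p \<in> Z"
    proof (rule ccontr)
      assume "p \<notin> Z"
      then have "Z \<subseteq> B" using Z(1) by auto
      then show False using Z B(2) columns_indep_iff[OF finB] by auto
    qed
    have finZ: "finite Z" using Z(1) finB finite_subset by auto
    have "A i p = (\<Sum>b\<in>Z - {p}. A i b)" if "i < m" for i
    proof -
      have "A i p + (\<Sum>b\<in>Z - {p}. A i b) = 0"
        using Z(2) that \<open>p \<in> Z\<close> sum.remove[OF finZ, of p "A i"] by (simp add: zero_sum_def)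
      then have "A i p + (A i p + (\<Sum>b\<in>Z - {p}. A i b)) = A i p" by simp
      then show ?thesis unfolding add.assoc[symmetric] add_self_bit by simp
    qed
    then show ?thesis using Z(1) by (intro exI[of _ "Z - {p}"]) auto
  qed
  then obtain F where "\<And>p. p \<in> E - B \<Longrightarrow> F p \<subseteq> B \<and> (\<forall>i<m. A i p = (\<Sum>b\<in>F p. A i b))"
    by metis
  then show ?thesis unfolding fundamental_family_def using assms by auto
qed

lemma even_card_sym_diff:
  assumes "finite S" "finite T"
  shows "even (card ((S - T) \<union> (T - S))) \<longleftrightarrow> (even (card S) \<longleftrightarrow> even (card T))"
proof -
  have "card ((S - T) \<union> (T - S)) = card (S - T) + card (T - S)"
    using assms by (intro card_Un_disjoint) auto
  moreover have "card S = card (S - T) + card (S \<inter> T)"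
    using assms by (metis card_Int_Diff add.commute)
  moreover have "card T = card (T - S) + card (S \<inter> T)"
    using assms by (metis card_Int_Diff add.commute inf_commute)
  ultimately show ?thesis by presburger
qed

text \<open>
  Exchange holds by counting over the two-element field. If no element of \<open>Y\<close> extends \<open>X\<close>, then
  \<open>X\<close> is a basis of \<open>X \<union> Y\<close>. As \<open>Y - X\<close> has more subsets than \<open>X - Y\<close>, two of its subsets have
  the same parities on \<open>X - Y\<close>, and their symmetric difference contradicts the independence
  of \<open>Y\<close>.
\<close>

lemma matroid_vector_matroid:
  fixes A :: "nat \<Rightarrow> 'a \<Rightarrow> bit"
  assumes fin: "finite E"
  shows "matroid (vector_matroid E m A)"
proof
  show "finite (ground (vector_matroid E m A))" using fin by (simp add: vector_matroid_def)
next
  fix X assume "indep (vector_matroid E m A) X"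
  then show "X \<subseteq> ground (vector_matroid E m A)" by (simp add: vector_matroid_def)
next
  show "indep (vector_matroid E m A) {}" by (simp add: vector_matroid_def columns_indep_def)
next
  fix X Y assume "indep (vector_matroid E m A) X" "Y \<subseteq> X"
  moreover from this have "finite X" using fin finite_subset by (auto simp: vector_matroid_def)
  moreover from this have "finite Y" using \<open>Y \<subseteq> X\<close> by (rule rev_finite_subset)
  ultimately show "indep (vector_matroid E m A) Y"
    by (auto simp: vector_matroid_def columns_indep_iff)
next
  fix X Y
  assume "indep (vector_matroid E m A) X" "indep (vector_matroid E m A) Y" and less: "card X < card Y"
  then have XY: "X \<subseteq> E" "columns_indep m A X" "Y \<subseteq> E" "columns_indep m A Y"
    by (auto simp: vector_matroid_def)
  have fins: "finite X" "finite Y" using XY fin finite_subset by auto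
  show "\<exists>y\<in>Y - X. indep (vector_matroid E m A) (insert y X)"
  proof (rule ccontr)
    assume "\<not> ?thesis"
    then have "\<not> columns_indep m A (insert p X)" if "p \<in> X \<union> Y - X" for p
      using that XY by (auto simp: vector_matroid_def)
    then obtain F where ff: "fundamental_family m A (X \<union> Y) X F"
      using fundamental_family_exists[of "X \<union> Y" X m A] fins XY by auto
    define odds where "odds Q = {b\<in>X - Y. odd (card {p\<in>Q. b \<in> F p})}" for Q
    have "card (X - Y) < card (Y - X)"
      using less card_Int_Diff[OF fins(1), of Y] card_Int_Diff[OF fins(2), of X]
      by (simp add: Int_commute)
    then have "card (Pow (X - Y)) < card (Pow (Y - X))" using fins by (simp add: card_Pow)
    moreover have "odds ` Pow (Y - X) \<subseteq> Pow (X - Y)" by (auto simp: odds_def)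
    ultimately have "\<not> inj_on odds (Pow (Y - X))"
      using fins by (metis card_inj_on_le finite_Diff finite_Pow_iff not_le)
    then obtain Q R where QR: "Q \<subseteq> Y - X" "R \<subseteq> Y - X" "odds Q = odds R" "Q \<noteq> R"
      unfolding inj_on_def by auto
    have finQR: "finite Q" "finite R" using QR fins finite_subset finite_Diff by metis+
    have "even (card {p \<in> (Q - R) \<union> (R - Q). b \<in> F p})" if b: "b \<in> X - Y" for b
    proof -
      have "even (card {p\<in>Q. b \<in> F p}) \<longleftrightarrow> even (card {p\<in>R. b \<in> F p})"
        using QR(3) b unfolding odds_def by auto
      moreover have "{p \<in> (Q - R) \<union> (R - Q). b \<in> F p} =
          ({p\<in>Q. b \<in> F p} - {p\<in>R. b \<in> F p}) \<union> ({p\<in>R. b \<in> F p} - {p\<in>Q. b \<in> F p})"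
        by auto
      ultimately show ?thesis
        using even_card_sym_diff[of "{p\<in>Q. b \<in> F p}" "{p\<in>R. b \<in> F p}"] finQR by simp
    qed
    moreover have "(Q - R) \<union> (R - Q) \<subseteq> Y - X" using QR(1,2) by auto
    ultimately have "(Q - R) \<union> (R - Q) = {}"
      using XY(4) columns_indep_fundamental[OF ff Un_upper2] by metis
    then show False using QR(4) by (metis Diff_eq_empty_iff Un_empty subset_antisym)
  qed
qed

section \<open>Almost disjoint fundamental sets give gammoids\<close>

lemma even_card_another:
  assumes "even (card S)" "x \<in> S" "finite S"
  shows "\<exists>y\<in>S. y \<noteq> x"
proof (rule ccontr)
  assume "\<not> ?thesis"
  then have "S = {x}" using assms(2) by blast
  then show False using assms(1) by simp
qed

definition hub_sets :: "'a set \<Rightarrow> ('a \<Rightarrow> 'a set) \<Rightarrow> 'a \<Rightarrow> 'a set set" where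
  "hub_sets N F a = F ` N \<union> (\<lambda>p. F p - {a}) ` N"

text \<open>
  The digraph for fundamental sets that are pairwise equal or disjoint up to the element \<open>a\<close>.
  Its vertices are the elements \<open>Inl p\<close> and a hub \<open>Inr G\<close> for each occurring set \<open>G\<close>; the targets
  are the basis elements. An element outside the basis has to enter the hub of its set, so that
  parallel elements block each other. A hub whose set contains \<open>a\<close> leads to \<open>a\<close> or, for the
  rest of the set, to the hub of \<open>G - {a}\<close>; a hub without \<open>a\<close> leads to all elements of its set.
\<close>

definition hub_arcs :: "'a set \<Rightarrow> ('a \<Rightarrow> 'a set) \<Rightarrow> 'a \<Rightarrow> (('a + 'a set) \<times> ('a + 'a set)) set" where
  "hub_arcs N F a = {(Inl p, Inr (F p)) | p. p \<in> N} \<union>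
     {(Inr G, Inr (G - {a})) | G. G \<in> hub_sets N F a \<and> a \<in> G} \<union>
     {(Inr G, Inl a) | G. G \<in> hub_sets N F a \<and> a \<in> G} \<union>
     {(Inr G, Inl d) | G d. G \<in> hub_sets N F a \<and> a \<notin> G \<and> d \<in> G}"

lemma hub_arcs_iff:
  "(Inl p, w) \<in> hub_arcs N F a \<longleftrightarrow> p \<in> N \<and> w = Inr (F p)"
  "(Inr G, Inr H) \<in> hub_arcs N F a \<longleftrightarrow> G \<in> hub_sets N F a \<and> a \<in> G \<and> H = G - {a}"
  "(Inr G, Inl d) \<in> hub_arcs N F a \<longleftrightarrow> G \<in> hub_sets N F a \<and> (if a \<in> G then d = a else d \<in> G)"
  by (auto simp: hub_arcs_def)

locale almost_disjoint_family =
  fixes E B X :: "'a set" and F :: "'a \<Rightarrow> 'a set" and a :: 'a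
  assumes fin: "finite E" and BE: "B \<subseteq> E" and XE: "X \<subseteq> E"
    and FB: "\<And>p. p \<in> E - B \<Longrightarrow> F p \<subseteq> B"
    and disj: "\<And>p q. p \<in> E - B \<Longrightarrow> q \<in> E - B \<Longrightarrow>
      F p - {a} = F q - {a} \<or> (F p - {a}) \<inter> (F q - {a}) = {}"
begin

definition "hubs = hub_sets (E - B) F a"
definition "R = hub_arcs (E - B) F a"
definition "V = Inl ` E \<union> Inr ` hubs"
definition "even_sums_outside Q \<longleftrightarrow> (\<forall>b\<in>B - X. even (card {p\<in>Q. b \<in> F p}))"

lemma sources: "V - Inl ` B = Inl ` (E - B) \<union> Inr ` hubs"
  by (auto simp: V_def)

lemma hub_F: "p \<in> E - B \<Longrightarrow> F p \<in> hubs" "p \<in> E - B \<Longrightarrow> F p - {a} \<in> hubs"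
  by (auto simp: hubs_def hub_sets_def)

lemma hub_obtain:
  assumes "G \<in> hubs"
  obtains p where "p \<in> E - B" "G - {a} = F p - {a}" "G \<subseteq> B"
proof -
  obtain p where p: "p \<in> E - B" "G = F p \<or> G = F p - {a}"
    using assms unfolding hubs_def hub_sets_def by auto
  show thesis by (rule that[OF p(1)]) (use p(2) FB[OF p(1)] in auto)
qed

text \<open>
  Suppose \<open>Q\<close> is a nonempty part of \<open>X\<close> whose sum lies in \<open>X\<close>. The map sends every element of
  \<open>Q\<close> to its hub, and a hub that is entered must be left. Leaving for a basis element \<open>d\<close> means
  \<open>d \<notin> X\<close>, so by parity \<open>d\<close> occurs in the fundamental set of a second element of \<open>Q\<close>; its set
  agrees with the first up to \<open>a\<close>, so both hubs over this set are in use, and one of them can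
  only be left for \<open>a\<close> (\<open>through_a\<close>). But then \<open>a \<notin> X\<close>, and parity at \<open>a\<close> yields a second
  set whose hub is also left for \<open>a\<close>, which injectivity forbids.
\<close>

lemma even_sums_empty_if_step_map:
  assumes g: "step_map R V (Inl ` B) g" and avoid: "g ` (V - Inl ` B) \<inter> Inl ` X = {}"
    and Q: "Q \<subseteq> X - B" "even_sums_outside Q"
  shows "Q = {}"
proof -
  have inj: "u = v" if "u \<in> V - Inl ` B" "v \<in> V - Inl ` B" "g u = g v" for u v
    using g that unfolding step_map_def by (metis inj_onD)
  have step: "g u = u \<or> (u, g u) \<in> R" if "u \<in> V - Inl ` B" for u
    using g that unfolding step_map_def by metis
  have notX: "d \<notin> X" if "g u = Inl d" "u \<in> V - Inl ` B" for u d
    using avoid that by (metis disjoint_iff image_eqI)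
  have QE: "p \<in> E - B" "p \<in> X" if "p \<in> Q" for p using that Q(1) XE by auto
  have finQ: "finite Q" using QE fin by (metis DiffD1 finite_subset subsetI)
  have src: "Inl p \<in> V - Inl ` B" "Inr (F p) \<in> V - Inl ` B" "Inr (F p - {a}) \<in> V - Inl ` B"
    if "p \<in> Q" for p
    using QE[OF that] hub_F unfolding sources by auto
  have gp: "g (Inl p) = Inr (F p)" if p: "p \<in> Q" for p
  proof -
    have "g (Inl p) \<noteq> Inl p" using notX[OF _ src(1)[OF p]] QE(2)[OF p] by metis
    then show ?thesis using step[OF src(1)[OF p]] by (simp add: R_def hub_arcs_iff)
  qed
  have F_inj: "p = q" if "p \<in> Q" "q \<in> Q" "F p = F q" for p q
    using inj[OF src(1)[OF that(1)] src(1)[OF that(2)]] gp that by simp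
  have another: "\<exists>r\<in>Q. r \<noteq> q \<and> b \<in> F r" if "q \<in> Q" "b \<in> F q" "b \<notin> X" for q b
  proof -
    have "b \<in> B - X" using FB[OF QE(1)[OF that(1)]] that by auto
    then have "even (card {r\<in>Q. b \<in> F r})" using Q(2) by (simp add: even_sums_outside_def)
    from even_card_another[OF this, of q] finQ that show ?thesis by auto
  qed
  have forced: "\<exists>r\<in>Q. r \<noteq> q \<and> F r - {a} = F q - {a}"
    if q: "q \<in> Q" and u: "u \<in> V - Inl ` B" "g u = Inr (F q - {a})" "u \<noteq> Inr (F q - {a})" for q u
  proof -
    let ?G = "F q - {a}"
    have "g (Inr ?G) \<noteq> Inr ?G" using inj[OF u(1) src(3)[OF q]] u by auto
    then have "(Inr ?G, g (Inr ?G)) \<in> R" using step[OF src(3)[OF q]] by simp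
    then obtain d where d: "g (Inr ?G) = Inl d" "d \<in> ?G"
      by (cases "g (Inr ?G)") (auto simp: R_def hub_arcs_iff)
    then obtain r where r: "r \<in> Q" "r \<noteq> q" "d \<in> F r"
      using another[OF q, of d] notX[OF d(1) src(3)[OF q]] by auto
    then have "F r - {a} = F q - {a}"
      using disj[OF QE(1)[OF r(1)] QE(1)[OF q]] d(2) by auto
    then show ?thesis using r by auto
  qed
  have through_a: "\<exists>q\<in>Q. a \<in> F q \<and> F q - {a} = F p - {a} \<and> g (Inr (F q)) = Inl a"
    if p: "p \<in> Q" for p
  proof -
    have "\<exists>q\<in>Q. a \<in> F q \<and> F q - {a} = F p - {a}"
    proof (cases "a \<in> F p")
      case False
      then have "F p - {a} = F p" by auto
      then obtain r where r: "r \<in> Q" "r \<noteq> p" "F r - {a} = F p - {a}"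
        using forced[OF p src(1)[OF p]] gp[OF p] by auto
      have "a \<in> F r"
      proof (rule ccontr)
        assume "a \<notin> F r"
        then have "F r = F p" using r(3) False by auto
        then show False using F_inj[OF r(1) p] r(2) by simp
      qed
      then show ?thesis using r by auto
    qed (use p in auto)
    then obtain q where q: "q \<in> Q" "a \<in> F q" "F q - {a} = F p - {a}" by auto
    have "g (Inr (F q)) = Inl a"
    proof (rule ccontr)
      assume not_a: "g (Inr (F q)) \<noteq> Inl a"
      have "g (Inr (F q)) \<noteq> Inr (F q)"
        using inj[OF src(1)[OF q(1)] src(2)[OF q(1)]] gp[OF q(1)] by auto
      then have "(Inr (F q), g (Inr (F q))) \<in> R" using step[OF src(2)[OF q(1)]] by simp
      then have to: "g (Inr (F q)) = Inr (F q - {a})"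
        using not_a q(2) by (cases "g (Inr (F q))") (auto simp: R_def hub_arcs_iff)
      then obtain r where r: "r \<in> Q" "r \<noteq> q" "F r - {a} = F q - {a}"
        using forced[OF q(1) src(2)[OF q(1)]] q(2) by auto
      show False
      proof (cases "a \<in> F r")
        case True
        then have "F r = F q" using r(3) q(2) by auto
        then show False using F_inj[OF r(1) q(1)] r(2) by simp
      next
        case False
        then have "g (Inl r) = g (Inr (F q))" using gp[OF r(1)] to r(3) by simp
        then show False using inj[OF src(1)[OF r(1)] src(2)[OF q(1)]] by simp
      qed
    qed
    then show ?thesis using q by auto
  qed
  show "Q = {}"
  proof (rule ccontr)
    assume "Q \<noteq> {}"
    then obtain q where q: "q \<in> Q" "a \<in> F q" "g (Inr (F q)) = Inl a"
      using through_a by (metis all_not_in_conv)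
    then obtain r where r: "r \<in> Q" "r \<noteq> q" "a \<in> F r"
      using another[OF q(1,2)] notX[OF q(3) src(2)[OF q(1)]] by auto
    obtain s where s: "s \<in> Q" "a \<in> F s" "F s - {a} = F r - {a}" "g (Inr (F s)) = Inl a"
      using through_a[OF r(1)] by auto
    have "F s = F r" using s r(3) by auto
    moreover have "F s = F q"
      using inj[OF src(2)[OF s(1)] src(2)[OF q(1)]] s(4) q(3) by simp
    ultimately show False using F_inj[OF r(1) q(1)] r(2) by simp
  qed
qed

text \<open>
  Independence leaves just enough room for the map. Distinct elements of \<open>X\<close> outside \<open>B\<close> have
  distinct fundamental sets. A hub without \<open>a\<close> that is in use can be left for an element
  outside \<open>X\<close>. A hub with \<open>a\<close> that is in use can pass its path on to the hub of \<open>G - {a}\<close>,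
  unless this one is occupied or has no exit (\<open>full\<close>); then it needs \<open>a\<close>. The sets for which
  this happens give rise to subsets of \<open>X\<close> with sum \<open>a\<close> up to elements of \<open>X\<close>, so \<open>a \<notin> X\<close>,
  and there is at most one such set since the union of two such subsets would be dependent.
\<close>

lemma step_map_if_even_sums_empty:
  assumes ind: "\<And>Q. Q \<subseteq> X - B \<Longrightarrow> even_sums_outside Q \<Longrightarrow> Q = {}"
  shows "\<exists>g. step_map R V (Inl ` B) g \<and> g ` (V - Inl ` B) \<inter> Inl ` X = {}"
proof -
  define used where "used G \<longleftrightarrow> (\<exists>p\<in>X - B. F p = G)" for G
  define full where "full G \<longleftrightarrow> used (insert a G) \<and> (used G \<or> G \<subseteq> X)" for G
  have XE': "p \<in> E - B" if "p \<in> X - B" for p using that XE by auto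
  have F_inj: "p = q" if pq: "p \<in> X - B" "q \<in> X - B" "F p = F q" for p q
  proof (rule ccontr)
    assume ne: "p \<noteq> q"
    have "even (card {r\<in>{p, q}. b \<in> F r})" for b
    proof (cases "b \<in> F p")
      case True
      then have "{r\<in>{p, q}. b \<in> F r} = {p, q}" using pq by auto
      then show ?thesis using ne by simp
    next
      case False
      then have "{r\<in>{p, q}. b \<in> F r} = {}" using pq by auto
      then show ?thesis by (metis card.empty even_zero)
    qed
    then have "even_sums_outside {p, q}" by (simp add: even_sums_outside_def)
    then show False using ind[of "{p, q}"] pq by auto
  qed
  have not_sub: "\<not> F p \<subseteq> X" if p: "p \<in> X - B" for p
  proof
    assume "F p \<subseteq> X"
    then have "{r\<in>{p}. b \<in> F r} = {}" if "b \<in> B - X" for b using that by auto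
    then have "even_sums_outside {p}"
      unfolding even_sums_outside_def by (metis card.empty even_zero)
    then show False using ind[of "{p}"] p by auto
  qed
  have full_sums: "\<exists>Q\<subseteq>X - B. p \<in> Q \<and> (\<forall>r\<in>Q. F r - {a} = F p - {a}) \<and>
      (\<forall>b\<in>B - X. b \<noteq> a \<longrightarrow> even (card {r\<in>Q. b \<in> F r})) \<and> card {r\<in>Q. a \<in> F r} = 1"
    if p: "p \<in> X - B" "a \<in> F p" "full (F p - {a})" for p
  proof (cases "used (F p - {a})")
    case True
    then obtain q where q: "q \<in> X - B" "F q = F p - {a}" by (auto simp: used_def)
    have ne: "p \<noteq> q" using p(2) q(2) by auto
    have "even (card {r\<in>{p, q}. b \<in> F r})" if "b \<noteq> a" for b
    proof (cases "b \<in> F p")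
      case True
      then have "{r\<in>{p, q}. b \<in> F r} = {p, q}" using q that by auto
      then show ?thesis using ne by simp
    next
      case False
      then have "{r\<in>{p, q}. b \<in> F r} = {}" using q by auto
      then show ?thesis by (metis card.empty even_zero)
    qed
    moreover have "{r\<in>{p, q}. a \<in> F r} = {p}" using p(2) q(2) by auto
    then have "card {r\<in>{p, q}. a \<in> F r} = 1" by simp
    ultimately show ?thesis using p q by (intro exI[of _ "{p, q}"]) auto
  next
    case False
    then have "F p - {a} \<subseteq> X" using p(3) by (simp add: full_def)
    then have "{r\<in>{p}. b \<in> F r} = {}" if "b \<in> B - X" "b \<noteq> a" for b using that by auto
    then have "\<forall>b\<in>B - X. b \<noteq> a \<longrightarrow> even (card {r\<in>{p}. b \<in> F r})"
      by (metis card.empty even_zero)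
    moreover have "{r\<in>{p}. a \<in> F r} = {p}" using p(2) by auto
    then have "card {r\<in>{p}. a \<in> F r} = 1" by simp
    ultimately show ?thesis using p by (intro exI[of _ "{p}"]) auto
  qed
  have a_free: "a \<notin> X" if p: "p \<in> X - B" "a \<in> F p" "full (F p - {a})" for p
  proof
    assume "a \<in> X"
    obtain Q where Q: "Q \<subseteq> X - B" "p \<in> Q"
      "\<forall>b\<in>B - X. b \<noteq> a \<longrightarrow> even (card {r\<in>Q. b \<in> F r})"
      using full_sums[OF p] by auto
    have "even_sums_outside Q"
      unfolding even_sums_outside_def using Q(3) \<open>a \<in> X\<close> by auto
    then show False using ind[OF Q(1)] Q(2) by auto
  qed
  have full_unique: "F p = F q"
    if p: "p \<in> X - B" "a \<in> F p" "full (F p - {a})"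
      and q: "q \<in> X - B" "a \<in> F q" "full (F q - {a})" for p q
  proof (rule ccontr)
    assume ne: "F p \<noteq> F q"
    obtain P where P: "P \<subseteq> X - B" "p \<in> P" "\<forall>r\<in>P. F r - {a} = F p - {a}"
      "\<forall>b\<in>B - X. b \<noteq> a \<longrightarrow> even (card {r\<in>P. b \<in> F r})" "card {r\<in>P. a \<in> F r} = 1"
      using full_sums[OF p] by auto
    obtain Q where Q: "Q \<subseteq> X - B" "q \<in> Q" "\<forall>r\<in>Q. F r - {a} = F q - {a}"
      "\<forall>b\<in>B - X. b \<noteq> a \<longrightarrow> even (card {r\<in>Q. b \<in> F r})" "card {r\<in>Q. a \<in> F r} = 1"
      using full_sums[OF q] by auto
    have "F p - {a} \<noteq> F q - {a}" using ne p(2) q(2) by auto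
    then have PQ: "P \<inter> Q = {}" using P(3) Q(3) by (metis disjoint_iff)
    have "finite X" using XE fin by (rule finite_subset)
    then have finPQ: "finite P" "finite Q" using P(1) Q(1) by (metis finite_Diff finite_subset)+
    have "even (card {r\<in>P \<union> Q. b \<in> F r})" if b: "b \<in> B - X" for b
    proof -
      have "{r\<in>P \<union> Q. b \<in> F r} = {r\<in>P. b \<in> F r} \<union> {r\<in>Q. b \<in> F r}" by auto
      moreover have "card ({r\<in>P. b \<in> F r} \<union> {r\<in>Q. b \<in> F r}) =
          card {r\<in>P. b \<in> F r} + card {r\<in>Q. b \<in> F r}"
        using finPQ PQ by (intro card_Un_disjoint) auto
      ultimately show ?thesis using P(4,5) Q(4,5) b by (cases "b = a") auto
    qed
    then have "even_sums_outside (P \<union> Q)" by (simp add: even_sums_outside_def)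
    then show False using ind[of "P \<union> Q"] P(1,2) Q(1) by auto
  qed
  define exit where "exit G = (SOME d. d \<in> G \<and> d \<notin> X)" for G
  define g where "g u = (case u of
      Inl p \<Rightarrow> if p \<in> X then Inr (F p) else Inl p
    | Inr G \<Rightarrow>
        if a \<in> G then if \<not> used G then Inr G else if full (G - {a}) then Inl a else Inr (G - {a})
        else if used G \<or> used (insert a G) \<and> \<not> full G then Inl (exit G) else Inr G)" for u
  have exit: "exit G \<in> G" "exit G \<notin> X"
    if "a \<notin> G" "used G \<or> used (insert a G) \<and> \<not> full G" for G
  proof -
    have "\<not> G \<subseteq> X" using that not_sub unfolding used_def full_def by metis
    then have "\<exists>d. d \<in> G \<and> d \<notin> X" by auto
    from someI_ex[OF this] show "exit G \<in> G" "exit G \<notin> X" by (auto simp: exit_def)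
  qed
  have hubB: "d \<in> B" if "G \<in> hubs" "d \<in> G" for G d
    using that by (metis hub_obtain subset_iff)
  have hub_disj: "G = H" if GH: "G \<in> hubs" "H \<in> hubs" "a \<notin> G" "a \<notin> H" "d \<in> G" "d \<in> H" for G H d
  proof -
    obtain p q where p: "p \<in> E - B" "G - {a} = F p - {a}" and q: "q \<in> E - B" "H - {a} = F q - {a}"
      using GH(1,2) by (metis hub_obtain)
    have "G - {a} = H - {a}" using disj[OF p(1) q(1)] p(2) q(2) GH by auto
    then show ?thesis using GH by auto
  qed
  have full_a: "a \<notin> X" if "used G" "a \<in> G" "full (G - {a})" for G
    using that a_free unfolding used_def by metis
  have full_one: "G = H" if "used G" "a \<in> G" "full (G - {a})" "used H" "a \<in> H" "full (H - {a})" for G H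
    using that full_unique unfolding used_def by metis
  have used_F: "used (F p)" if "p \<in> E - B" "p \<in> X" for p using that by (auto simp: used_def)
  have ins: "insert a (G - {a}) = G" if "a \<in> G" for G using that by auto
  have gl: "g (Inl p) = (if p \<in> X then Inr (F p) else Inl p)" for p by (simp add: g_def)
  have gr: "g (Inr G) = (
        if a \<in> G then if \<not> used G then Inr G else if full (G - {a}) then Inl a else Inr (G - {a})
        else if used G \<or> used (insert a G) \<and> \<not> full G then Inl (exit G) else Inr G)" for G
    by (simp add: g_def)
  have ll: "p = q" if "p \<in> E - B" "q \<in> E - B" "g (Inl p) = g (Inl q)" for p q
    using that F_inj by (auto simp: gl split: if_splits)
  have lr: "g (Inl p) \<noteq> g (Inr G)" if p: "p \<in> E - B" and G: "G \<in> hubs" for p G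
  proof (cases "p \<in> X")
    case True
    then have u: "used (F p)" using p used_F by simp
    have "\<not> full (G - {a}) \<Longrightarrow> used G \<Longrightarrow> a \<in> G \<Longrightarrow> F p \<noteq> G - {a}"
      using u ins[of G] unfolding full_def by metis
    then show ?thesis using True u by (auto simp: gl gr)
  next
    case False
    have "p \<noteq> a" if "a \<in> G" using hubB[OF G that] p by auto
    moreover have "p \<noteq> exit G" if "a \<notin> G" "used G \<or> used (insert a G) \<and> \<not> full G"
      using hubB[OF G exit(1)[OF that]] p by auto
    ultimately show ?thesis using False by (auto simp: gl gr)
  qed
  have rr: "G = H" if G: "G \<in> hubs" and H: "H \<in> hubs" and eq: "g (Inr G) = g (Inr H)" for G H
  proof -
    have mixed: False if "a \<in> G" "a \<notin> H" "g (Inr G) = g (Inr H)" for G H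
    proof (cases "used G")
      case False
      then show ?thesis using that by (auto simp: gr split: if_splits)
    next
      case used: True
      show ?thesis
      proof (cases "full (G - {a})")
        case True
        then have "exit H = a" "used H \<or> used (insert a H) \<and> \<not> full H"
          using that used by (auto simp: gr split: if_splits)
        then show ?thesis using exit(1)[OF that(2)] that(2) by auto
      next
        case False
        then have "H = G - {a}" "\<not> (used (insert a H) \<and> \<not> full H)"
          using that used by (auto simp: gr split: if_splits)
        then show ?thesis using False used ins[OF that(1)] by simp
      qed
    qed
    consider "a \<in> G" "a \<in> H" | "a \<notin> G" "a \<notin> H" | "a \<in> G" "a \<notin> H" | "a \<notin> G" "a \<in> H" by metis
    then show ?thesis
    proof cases
      case 1
      show ?thesis
      proof (cases "used G \<and> used H \<and> full (G - {a}) \<and> full (H - {a})")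
        case True
        then show ?thesis using full_one 1 by metis
      next
        case False
        then show ?thesis using eq 1 ins[of G] ins[of H]
          by (auto simp: gr split: if_splits)
      qed
    next
      case 2
      show ?thesis
      proof (cases "(used G \<or> used (insert a G) \<and> \<not> full G) \<and> (used H \<or> used (insert a H) \<and> \<not> full H)")
        case True
        then have "exit G = exit H" using eq 2 by (simp add: gr)
        then show ?thesis using hub_disj[OF G H 2] exit(1)[OF 2(1)] exit(1)[OF 2(2)] True by metis
      next
        case False
        then show ?thesis using eq 2 by (auto simp: gr split: if_splits)
      qed
    next
      case 3
      then show ?thesis using mixed eq by metis
    next
      case 4
      then show ?thesis using mixed eq by metis
    qed
  qed
  have "inj_on g (V - Inl ` B)"
  proof (rule inj_onI)
    fix u v assume u: "u \<in> V - Inl ` B" and v: "v \<in> V - Inl ` B" and eq: "g u = g v"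
    show "u = v"
    proof (cases u; cases v)
      fix p q assume "u = Inl p" "v = Inl q"
      then show ?thesis using ll[of p q] u v eq unfolding sources by auto
    next
      fix p G assume "u = Inl p" "v = Inr G"
      then show ?thesis using lr[of p G] u v eq unfolding sources by auto
    next
      fix p G assume "u = Inr G" "v = Inl p"
      then show ?thesis using lr[of p G] u v eq[symmetric] unfolding sources by auto
    next
      fix G H assume "u = Inr G" "v = Inr H"
      then show ?thesis using rr[of G H] u v eq unfolding sources by auto
    qed
  qed
  moreover have "g u = u \<or> (u, g u) \<in> R" if u: "u \<in> V - Inl ` B" for u
  proof (cases u)
    case (Inl p)
    then show ?thesis using u unfolding sources by (auto simp: gl R_def hub_arcs_iff)
  next
    case (Inr G)
    then have "G \<in> hubs" using u unfolding sources by auto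
    then show ?thesis using Inr exit(1)[of G]
      by (auto simp: gr R_def hub_arcs_iff hubs_def)
  qed
  moreover have "g u \<notin> Inl ` X" if u: "u \<in> V - Inl ` B" for u
  proof (cases u)
    case (Inl p)
    then show ?thesis by (auto simp: gl)
  next
    case (Inr G)
    then show ?thesis using full_a[of G] exit(2)[of G] by (auto simp: gr split: if_splits)
  qed
  ultimately have "step_map R V (Inl ` B) g \<and> g ` (V - Inl ` B) \<inter> Inl ` X = {}"
    unfolding step_map_def disjoint_iff by (metis imageE)
  then show ?thesis by metis
qed

lemma V_facts: "finite V" "Inl ` B \<subseteq> V" "R \<subseteq> V \<times> V"
proof -
  show "finite V" using fin by (simp add: V_def hubs_def hub_sets_def)
  show "Inl ` B \<subseteq> V" using BE by (auto simp: V_def)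
  have hub: "G - {a} \<in> hubs" "G \<subseteq> E" if G: "G \<in> hubs" for G
  proof -
    obtain p where "p \<in> E - B" "G - {a} = F p - {a}" "G \<subseteq> B" using G by (rule hub_obtain)
    then show "G - {a} \<in> hubs" "G \<subseteq> E" using hub_F(2) BE by auto
  qed
  show "R \<subseteq> V \<times> V"
  proof
    fix e assume "e \<in> R"
    then show "e \<in> V \<times> V"
      unfolding R_def hub_arcs_def hubs_def[symmetric] V_def
      using hub hub_F(1) by auto
  qed
qed

end

text \<open>
  When \<open>a\<close> is the element added by a splitting, the second hypothesis says that the fundamental
  sets before the splitting were pairwise equal or disjoint.
\<close>

lemma gammoid_fundamental_family:
  fixes A :: "nat \<Rightarrow> 'a \<Rightarrow> bit"
  assumes ff: "fundamental_family m A E B F"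
    and disj: "\<And>p q. p \<in> E - B \<Longrightarrow> q \<in> E - B \<Longrightarrow>
      F p - {a} = F q - {a} \<or> (F p - {a}) \<inter> (F q - {a}) = {}"
  shows "gammoid (vector_matroid E m A)"
proof -
  have adf: "almost_disjoint_family E B X F a" if "X \<subseteq> E" for X
    using ff disj that unfolding fundamental_family_def by unfold_locales auto
  let ?V = "almost_disjoint_family.V E B F a" and ?R = "almost_disjoint_family.R E B F a"
  note VR = almost_disjoint_family.V_facts[OF adf[OF empty_subsetI]]
  show ?thesis
  proof (rule gammoid_if_step_maps[where \<phi> = Inl, OF _ VR])
    show "matroid (vector_matroid E m A)"
      using ff by (intro matroid_vector_matroid) (simp add: fundamental_family_def)
    show "inj_on Inl (ground (vector_matroid E m A))" by simp
    show "Inl ` ground (vector_matroid E m A) \<subseteq> ?V"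
      by (auto simp: vector_matroid_def almost_disjoint_family.V_def[OF adf[OF empty_subsetI]])
    fix X assume "X \<subseteq> ground (vector_matroid E m A)"
    then have X: "X \<subseteq> E" by (simp add: vector_matroid_def)
    note adX = adf[OF X]
    have "indep (vector_matroid E m A) X \<longleftrightarrow>
        (\<forall>Q\<subseteq>X - B. almost_disjoint_family.even_sums_outside B X F Q \<longrightarrow> Q = {})"
      using X columns_indep_fundamental[OF ff X]
      by (simp add: vector_matroid_def almost_disjoint_family.even_sums_outside_def[OF adX])
    also have "\<dots> \<longleftrightarrow> (\<exists>g. step_map ?R ?V (Inl ` B) g \<and> g ` (?V - Inl ` B) \<inter> Inl ` X = {})"
      using almost_disjoint_family.even_sums_empty_if_step_map[OF adX]
        almost_disjoint_family.step_map_if_even_sums_empty[OF adX] by metis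
    finally show "indep (vector_matroid E m A) X \<longleftrightarrow>
        (\<exists>g. step_map ?R ?V (Inl ` B) g \<and> g ` (?V - Inl ` B) \<inter> Inl ` X = {})" .
  qed
qed

section \<open>Fundamental sets of the es-splitting\<close>

text \<open>
  The column of \<open>None\<close> is the unit vector of the new row. Hence it completes the old basis, and
  it enters a fundamental set precisely when the old sum has the wrong parity in that row.
\<close>

lemma fundamental_family_split_matrix:
  assumes ff: "fundamental_family m A E B F"
  shows "fundamental_family (Suc m) (split_matrix H m A) (insert None (Some ` E)) (insert None (Some ` B))
    (case_option {} (\<lambda>p. Some ` F p \<union>
      (if (if p \<in> H then 1 else 0) + (\<Sum>b\<in>F p. if b \<in> H then 1 else 0 :: bit) = 0 then {} else {None})))"
    (is "fundamental_family _ ?A ?E ?B ?F")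
proof -
  have fin: "finite E" "finite B"
    using ff finite_subset unfolding fundamental_family_def by metis+
  have BE: "B \<subseteq> E" and cB: "columns_indep m A B"
    and F: "\<And>p. p \<in> E - B \<Longrightarrow> F p \<subseteq> B" "\<And>p i. p \<in> E - B \<Longrightarrow> i < m \<Longrightarrow> A i p = (\<Sum>b\<in>F p. A i b)"
    using ff unfolding fundamental_family_def by auto
  have indep_B: "columns_indep (Suc m) ?A ?B"
  proof -
    have "Z = {}" if Z: "Z \<subseteq> ?B" "zero_sum (Suc m) ?A Z" for Z
    proof -
      have finZ: "finite Z" using Z(1) fin finite_subset by auto
      note zs = Z(2)[unfolded zero_sum_split_matrix[OF finZ]]
      have "{x. Some x \<in> Z} \<subseteq> B" using Z(1) by auto
      then have none: "{x. Some x \<in> Z} = {}"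
        using zs cB unfolding columns_indep_iff[OF fin(2)] by metis
      then have "None \<notin> Z" using zs unfolding none by (auto split: if_splits)
      show ?thesis
      proof (rule ccontr)
        assume "Z \<noteq> {}"
        then obtain z where "z \<in> Z" by auto
        then show False using none \<open>None \<notin> Z\<close> by (cases z) auto
      qed
    qed
    then show ?thesis using columns_indep_iff[of ?B "Suc m" ?A] fin by auto
  qed
  have fund: "?F z \<subseteq> ?B \<and> (\<forall>i<Suc m. ?A i z = (\<Sum>b\<in>?F z. ?A i b))" if z: "z \<in> ?E - ?B" for z
  proof -
    obtain p where p: "z = Some p" "p \<in> E - B" using z by auto
    have finF: "finite (F p)" using F(1)[OF p(2)] fin(2) by (rule finite_subset)
    have finFz: "finite (?F z)" using finF p(1) by simp
    have old: "{x. Some x \<in> ?F z} = F p" using p(1) by auto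
    have none: "None \<in> ?F z \<longleftrightarrow>
        (if p \<in> H then 1 else 0) + (\<Sum>b\<in>F p. if b \<in> H then 1 else 0 :: bit) \<noteq> 0"
      using p(1) by auto
    have "?A i z = (\<Sum>b\<in>?F z. ?A i b)" if i: "i < Suc m" for i
      unfolding sum_option[OF finFz] old
    proof (cases "i = m")
      case True
      have cancel: "x = y" if "x + y = 0" for x y :: bit
        using that by (cases x; cases y) (auto simp: add_self_bit)
      have flip: "x = 1 + y" if "x + y \<noteq> 0" for x y :: bit
        using that by (cases x; cases y) (auto simp: add_self_bit)
      show "?A i z = (if None \<in> ?F z then ?A i None else 0) + (\<Sum>x\<in>F p. ?A i (Some x))"
      proof (cases "None \<in> ?F z")
        case True
        from flip[OF this[unfolded none]] show ?thesis
          using True \<open>i = m\<close> p(1) by (simp add: split_matrix_def)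
      next
        case False
        from cancel[OF this[unfolded none not_not]] show ?thesis
          using False \<open>i = m\<close> p(1) by (simp add: split_matrix_def)
      qed
    next
      case False
      then show "?A i z = (if None \<in> ?F z then ?A i None else 0) + (\<Sum>x\<in>F p. ?A i (Some x))"
        using F(2)[OF p(2)] i p(1) by (simp add: split_matrix_def)
    qed
    moreover have "?F z \<subseteq> ?B" using F(1)[OF p(2)] p(1) by auto
    ultimately show ?thesis by simp
  qed
  show ?thesis
    unfolding fundamental_family_def
  proof (intro conjI)
    show "finite ?E" "?B \<subseteq> ?E" using fin BE by auto
  qed (rule indep_B, rule ballI, rule fund)
qed

lemma fundamental_family_copy_column:
  assumes ff: "fundamental_family m A E B F" and e: "e \<in> E"
  shows "fundamental_family m (copy_column e A) (insert None (Some ` E)) (Some ` B)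
    (case_option (Some ` (if e \<in> B then {e} else F e)) (\<lambda>p. Some ` F p))"
    (is "fundamental_family _ ?A ?E ?B ?F")
proof -
  have fin: "finite E" "finite B"
    using ff finite_subset unfolding fundamental_family_def by metis+
  have BE: "B \<subseteq> E" and cB: "columns_indep m A B"
    and F: "\<And>p. p \<in> E - B \<Longrightarrow> F p \<subseteq> B" "\<And>p i. p \<in> E - B \<Longrightarrow> i < m \<Longrightarrow> A i p = (\<Sum>b\<in>F p. A i b)"
    using ff unfolding fundamental_family_def by auto
  have sum_Some: "(\<Sum>z\<in>Some ` S. ?A i z) = (\<Sum>x\<in>S. A i x)" for S i
    by (simp add: sum.reindex copy_column_def)
  have indep_B: "columns_indep m ?A ?B"
  proof -
    have "Z = {}" if Z: "Z \<subseteq> ?B" "zero_sum m ?A Z" for Z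
    proof -
      obtain S where S: "S \<subseteq> B" "Z = Some ` S" using Z(1) by (metis subset_imageE)
      have "zero_sum m A S" using Z(2) unfolding S(2) zero_sum_def sum_Some .
      then show ?thesis using cB S unfolding columns_indep_iff[OF fin(2)] by auto
    qed
    then show ?thesis using columns_indep_iff[of ?B m ?A] fin by auto
  qed
  have fund: "?F z \<subseteq> ?B \<and> (\<forall>i<m. ?A i z = (\<Sum>b\<in>?F z. ?A i b))" if z: "z \<in> ?E - ?B" for z
  proof (cases z)
    case None
    have "?A i None = (\<Sum>x\<in>(if e \<in> B then {e} else F e). A i x)" if "i < m" for i
      using F(2)[of e i] e that by (auto simp: copy_column_def)
    then show ?thesis using None F(1)[of e] e by (auto simp: sum_Some)
  next
    case (Some p)
    then have p: "p \<in> E - B" using z by auto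
    then show ?thesis using Some F(1)[OF p] F(2)[OF p] sum_Some by (auto simp: copy_column_def)
  qed
  show ?thesis
    unfolding fundamental_family_def
  proof (intro conjI)
    show "finite ?E" "?B \<subseteq> ?E" using fin BE by auto
  qed (rule indep_B, rule ballI, rule fund)
qed

text \<open>
  For the parallel copy of \<open>e\<close> the fundamental set is \<open>{e}\<close> if \<open>e\<close> is a basis element. This fits
  a disjoint family only if \<open>e\<close> lies in no other fundamental set, so \<open>e\<close> must be kept out of the
  basis unless it is a coloop: the basis extends a maximal independent subset of \<open>E - {e}\<close>.
\<close>

lemma fundamental_family_avoiding:
  fixes A :: "nat \<Rightarrow> 'a \<Rightarrow> bit"
  assumes fin: "finite E" and e: "e \<in> E"
  shows "\<exists>B F. fundamental_family m A E B F \<and> (\<forall>p\<in>E - B. e \<notin> F p)"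
proof -
  let ?I = "{S. S \<subseteq> E - {e} \<and> columns_indep m A S}"
  have "finite ?I" using fin by simp
  moreover have "{} \<in> ?I" by (simp add: columns_indep_def)
  ultimately obtain B where B: "B \<in> ?I" and max: "\<forall>S\<in>?I. B \<subseteq> S \<longrightarrow> B = S"
    using finite_has_maximal2[of ?I "{}"] by auto
  have dep: "\<not> columns_indep m A (insert p B)" if "p \<in> E - {e} - B" for p
  proof
    assume "columns_indep m A (insert p B)"
    then have "insert p B \<in> ?I" using that B by auto
    from max[rule_format, OF this subset_insertI] have "p \<in> B" by (metis insertI1)
    then show False using that by simp
  qed
  show ?thesis
  proof (cases "columns_indep m A (insert e B)")
    case True
    obtain F where F: "fundamental_family m A (E - {e}) B F"
      using fundamental_family_exists[of "E - {e}" B m A] fin B dep by auto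
    have "E - insert e B = E - {e} - B" by auto
    then have "fundamental_family m A E (insert e B) F \<and> (\<forall>p\<in>E - insert e B. e \<notin> F p)"
      using F True e fin B unfolding fundamental_family_def by auto
    then show ?thesis by metis
  next
    case False
    then have "\<not> columns_indep m A (insert p B)" if "p \<in> E - B" for p
      using dep that by (cases "p = e") auto
    then obtain F where F: "fundamental_family m A E B F"
      using fundamental_family_exists[of E B m A] fin B by auto
    have "e \<notin> F p" if "p \<in> E - B" for p
      using F that B unfolding fundamental_family_def by auto
    then show ?thesis using F by metis
  qed
qed

section \<open>Excluding the minor\<close>

text \<open>
  A cycle of \<open>G7\<close> has at most three edges. Two edges form a cycle only if they are parallel, and
  any three edges contain one of the listed sets.
\<close>

lemma indep_cycle_matroid_G7:
  "indep (cycle_matroid G7) X \<longleftrightarrow>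
     X \<subseteq> {0, 1, 2, 3} \<and> \<not> {2, 3} \<subseteq> X \<and> \<not> {0, 1, 2} \<subseteq> X \<and> \<not> {0, 1, 3} \<subseteq> X"
proof -
  have cycle_cases: "{2, 3} \<subseteq> set es \<or> {0, 1, 2} \<subseteq> set es \<or> {0, 1, 3} \<subseteq> set es"
    if c: "is_cycle G7 vs es" for vs es
  proof -
    have len: "length vs = length es" and ne: "es \<noteq> []"
      and dist: "distinct vs" "distinct es" and sub: "set vs \<subseteq> {0, 1, 2}" "set es \<subseteq> {0, 1, 2, 3}"
      and ends: "\<And>i. i < length es \<Longrightarrow> ends G7 (es ! i) = {vs ! i, vs ! (Suc i mod length es)}"
      using c unfolding is_cycle_def by (auto simp: G7_def)
    have "length vs \<le> 3"
      using card_mono[OF _ sub(1)] distinct_card[OF dist(1)] by simp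
    then consider "length es = 1" | "length es = 2" | "length es = 3"
      using len ne by (cases es) (auto simp: le_Suc_eq numeral_3_eq_3)
    then show ?thesis
    proof cases
      case 1
      then obtain f where f: "es = [f]" by (auto simp: length_Suc_conv)
      then have "card (ends G7 f) \<le> 1" using ends[of 0] by simp
      moreover have "f \<in> {0, 1, 2, 3}" using sub(2) f by simp
      ultimately show ?thesis by (auto simp: G7_def)
    next
      case 2
      then obtain f h where f: "es = [f, h]" by (auto simp: length_Suc_conv numeral_2_eq_2)
      have "ends G7 f = ends G7 h"
        using ends[of 0] ends[of 1] f by (simp add: insert_commute)
      moreover have "f \<in> {0, 1, 2, 3}" "h \<in> {0, 1, 2, 3}" "f \<noteq> h" using sub(2) f dist by auto
      ultimately show ?thesis using f by (auto simp: G7_def doubleton_eq_iff)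
    next
      case 3
      have "card ({0, 1, 2, 3} - set es) = 1"
        using card_Diff_subset[OF _ sub(2)] distinct_card[OF dist(2)] 3 by simp
      then obtain k where k: "{0, 1, 2, 3} - set es = {k}" by (rule card_1_singletonE)
      then have "k \<in> {0, 1, 2, 3}" by (metis DiffD1 insertI1)
      moreover have "set es = {0, 1, 2, 3} - {k}" using k sub(2) by (metis double_diff subset_refl)
      ultimately show ?thesis by (elim insertE emptyE) simp_all
    qed
  qed
  have "is_cycle G7 [1, 2] [2, 3]"
    by (simp add: is_cycle_def G7_def All_less_Suc insert_commute)
  moreover have "is_cycle G7 [1, 0, 2] [0, 1, 2]" "is_cycle G7 [1, 0, 2] [0, 1, 3]"
    by (simp_all add: is_cycle_def G7_def All_less_Suc insert_commute)
  ultimately have "\<exists>vs es. is_cycle G7 vs es \<and> set es \<subseteq> X"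
    if "{2, 3} \<subseteq> X \<or> {0, 1, 2} \<subseteq> X \<or> {0, 1, 3} \<subseteq> X"
    using that by (metis list.set(1,2))
  moreover have "{2, 3} \<subseteq> X \<or> {0, 1, 2} \<subseteq> X \<or> {0, 1, 3} \<subseteq> X"
    if cyc: "\<exists>vs es. is_cycle G7 vs es \<and> set es \<subseteq> X"
  proof -
    obtain vs es where "is_cycle G7 vs es" and sub: "set es \<subseteq> X" using cyc by auto
    from cycle_cases[OF this(1)] show ?thesis
      by (elim disjE) (drule subset_trans[OF _ sub], simp)+
  qed
  ultimately have "(\<exists>vs es. is_cycle G7 vs es \<and> set es \<subseteq> X) \<longleftrightarrow>
      {2, 3} \<subseteq> X \<or> {0, 1, 2} \<subseteq> X \<or> {0, 1, 3} \<subseteq> X"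
    by (rule iffI[rotated])
  moreover have "edges G7 = {0, 1, 2, 3}" by (simp add: G7_def)
  ultimately show ?thesis
    by (simp only: cycle_matroid_def indep_system.select_convs de_Morgan_disj)
qed

lemma ground_cycle_matroid_G7: "ground (cycle_matroid G7) = {0, 1, 2, 3}"
  by (simp add: cycle_matroid_def G7_def)

lemma basis_of_indep_set:
  assumes "indep M Y"
  shows "basis_of M Y J \<longleftrightarrow> J = Y"
  using assms unfolding basis_of_def by (metis subset_refl subset_antisym)

text \<open>
  Delete all elements outside the basis except \<open>p\<close> and \<open>q\<close>, and contract the basis except \<open>c\<close>
  and \<open>d\<close>. What remains of \<open>p\<close> is the sum of \<open>c\<close> and \<open>d\<close>, and \<open>q\<close> becomes parallel to \<open>c\<close>.
\<close>

lemma G7_minor_if_private_element: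
  assumes rep: "represents m A M" and ff: "fundamental_family m A (ground M) B F"
    and p: "p \<in> ground M - B" and q: "q \<in> ground M - B"
    and c: "c \<in> F p" "c \<in> F q" and d: "d \<in> F p" "d \<notin> F q"
  shows "has_minor_iso M (cycle_matroid G7)"
proof -
  let ?E = "ground M"
  have FB: "F p \<subseteq> B" "F q \<subseteq> B" and BE: "B \<subseteq> ?E"
    using ff p q by (auto simp: fundamental_family_def)
  have cd: "c \<in> B" "d \<in> B" "c \<noteq> d" "p \<noteq> q" using c d FB by auto
  have ne: "p \<noteq> c" "p \<noteq> d" "q \<noteq> c" "q \<noteq> d" using cd p q by auto
  define X where "X = ?E - B - {p, q}"
  define Y where "Y = B - {c, d}"
  define N where "N = contract (delete M X) Y"
  have ind: "indep M Z \<longleftrightarrow> Z \<subseteq> ?E \<and> columns_indep m A Z" for Z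
    using rep unfolding represents_def by (metis indep_system.select_convs(2) vector_matroid_def)
  have ground_N: "ground N = {c, d, p, q}"
    using cd p q BE unfolding N_def contract_def delete_def X_def Y_def by auto
  have indep_minor: "indep M (I \<union> Y) \<longleftrightarrow>
      \<not> {p, c, d} \<subseteq> I \<and> \<not> {q, c} \<subseteq> I \<and> \<not> {p, q, d} \<subseteq> I"
    if I: "I \<subseteq> {c, d, p, q}" for I
  proof -
    have IY: "I \<union> Y \<subseteq> ?E" using I cd p q BE by (auto simp: Y_def)
    have non_basis: "I \<union> Y - B = I \<inter> {p, q}" using I cd p q by (auto simp: Y_def)
    have missing: "B - (I \<union> Y) = {c, d} - I" using I cd p q by (auto simp: Y_def)
    have c1: "{r\<in>{p}. c \<in> F r} = {p}" "{r\<in>{q}. c \<in> F r} = {q}" "{r\<in>{p, q}. c \<in> F r} = {p, q}"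
      using c by auto
    have d1: "{r\<in>{p}. d \<in> F r} = {p}" "{r\<in>{q}. d \<in> F r} = {}" "{r\<in>{p, q}. d \<in> F r} = {p}"
      using d by auto
    have subs: "(\<forall>Q\<subseteq>I \<inter> {p, q}. P Q) \<longleftrightarrow>
        P {} \<and> (p \<in> I \<longrightarrow> P {p}) \<and> (q \<in> I \<longrightarrow> P {q}) \<and> (p \<in> I \<and> q \<in> I \<longrightarrow> P {p, q})" for P
    proof (intro iffI allI impI)
      fix Q assume P: "P {} \<and> (p \<in> I \<longrightarrow> P {p}) \<and> (q \<in> I \<longrightarrow> P {q}) \<and> (p \<in> I \<and> q \<in> I \<longrightarrow> P {p, q})"
        and Q: "Q \<subseteq> I \<inter> {p, q}"
      have "Q = (if p \<in> Q then {p} else {}) \<union> (if q \<in> Q then {q} else {})" using Q by auto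
      then have "Q = {} \<or> Q = {p} \<or> Q = {q} \<or> Q = {p, q}" by (auto split: if_splits)
      then show "P Q" using P Q by auto
    qed auto
    have cols: "columns_indep m A (I \<union> Y) \<longleftrightarrow>
      (\<forall>Q\<subseteq>I \<inter> {p, q}. (\<forall>b\<in>{c, d} - I. even (card {r\<in>Q. b \<in> F r})) \<longrightarrow> Q = {})"
      using columns_indep_fundamental[OF ff IY] unfolding non_basis missing .
    have even_cd: "(\<forall>b\<in>{c, d} - I. even (card {r\<in>Q. b \<in> F r})) \<longleftrightarrow>
      (c \<notin> I \<longrightarrow> even (card {r\<in>Q. c \<in> F r})) \<and> (d \<notin> I \<longrightarrow> even (card {r\<in>Q. d \<in> F r}))" for Q
      by auto
    have "columns_indep m A (I \<union> Y) \<longleftrightarrow>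
      (p \<in> I \<longrightarrow> \<not> (c \<in> I \<and> d \<in> I)) \<and> (q \<in> I \<longrightarrow> c \<notin> I) \<and> (p \<in> I \<and> q \<in> I \<longrightarrow> d \<notin> I)"
      unfolding cols subs even_cd c1 d1 using cd by simp
    then show ?thesis using ind IY by auto
  qed
  have indep_N: "indep N I \<longleftrightarrow> indep M (I \<union> Y)" if I: "I \<subseteq> {c, d, p, q}" for I
  proof -
    have XY: "X \<inter> (I \<union> Y) = {}" "X \<inter> Y = {}" using I cd by (auto simp: X_def Y_def)
    have "indep M Y" using indep_minor[of "{}"] by simp
    then have "indep (delete M X) Y" using XY(2) by (auto simp: delete_def)
    from basis_of_indep_set[OF this] have "indep N I \<longleftrightarrow> I \<subseteq> ground N \<and> indep (delete M X) (I \<union> Y)"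
      by (simp add: N_def contract_def)
    also have "\<dots> \<longleftrightarrow> indep M (I \<union> Y)"
      using I XY(1) ground_N by (simp add: delete_def Int_commute)
    finally show ?thesis .
  qed
  \<comment> \<open>The parallel pair \<open>c\<close>, \<open>q\<close> corresponds to the parallel edges \<open>2\<close>, \<open>3\<close> of \<open>G7\<close>.\<close>
  define f :: "'a \<Rightarrow> nat" where "f x = (if x = c then 2 else if x = q then 3 else if x = d then 0 else 1)" for x
  have f: "f c = 2" "f q = 3" "f d = 0" "f p = 1" using cd ne by (auto simp: f_def)
  have "inj_on f {c, d, p, q}" using f cd ne by simp
  then have bij: "bij_betw f (ground N) (ground (cycle_matroid G7))"
    unfolding bij_betw_def ground_N ground_cycle_matroid_G7 using f by auto
  have "indep N I \<longleftrightarrow> indep (cycle_matroid G7) (f ` I)" if I: "I \<subseteq> ground N" for I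
  proof -
    have I': "I \<subseteq> {c, d, p, q}" using I by (simp add: ground_N)
    have mem: "f x \<in> f ` I \<longleftrightarrow> x \<in> I" if "x \<in> {c, d, p, q}" for x
      using inj_on_image_mem_iff[OF \<open>inj_on f {c, d, p, q}\<close> that I'] .
    have "2 \<in> f ` I \<longleftrightarrow> c \<in> I" "3 \<in> f ` I \<longleftrightarrow> q \<in> I" "0 \<in> f ` I \<longleftrightarrow> d \<in> I" "1 \<in> f ` I \<longleftrightarrow> p \<in> I"
      using mem[of c] mem[of q] mem[of d] mem[of p] f by simp_all
    moreover have "f ` I \<subseteq> {0, 1, 2, 3}" using I' f by auto
    ultimately show ?thesis
      unfolding indep_N[OF I'] indep_minor[OF I'] indep_cycle_matroid_G7 by auto
  qed
  then have "matroid_iso N (cycle_matroid G7)" unfolding matroid_iso_def using bij by metis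
  moreover have "X \<subseteq> ?E" "Y \<subseteq> ?E" "X \<inter> Y = {}" using BE by (auto simp: X_def Y_def)
  then have "is_minor N M" unfolding is_minor_def N_def by metis
  ultimately show ?thesis unfolding has_minor_iso_def by metis
qed

lemma G7_minor_if_fundamental_sets_overlap:
  assumes rep: "represents m A M" and ff: "fundamental_family m A (ground M) B F"
    and p: "p \<in> ground M - B" and q: "q \<in> ground M - B"
    and overlap: "F p \<noteq> F q" "F p \<inter> F q \<noteq> {}"
  shows "has_minor_iso M (cycle_matroid G7)"
proof -
  obtain c where c: "c \<in> F p" "c \<in> F q" using overlap(2) by auto
  consider d where "d \<in> F p" "d \<notin> F q" | d where "d \<in> F q" "d \<notin> F p"
    using overlap(1) by auto
  then show ?thesis
  proof cases
    case 1
    show ?thesis by (rule G7_minor_if_private_element[OF rep ff p q c 1])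
  next
    case 2
    show ?thesis by (rule G7_minor_if_private_element[OF rep ff q p c(2,1) 2])
  qed
qed

lemma es_splitting_eq:
  fixes A :: "nat \<Rightarrow> 'a \<Rightarrow> bit"
  assumes "represents m A M" "finite (ground M)" "e \<in> ground M"
  shows "es_splitting M T e = vector_matroid (insert None (Some ` insert None (Some ` ground M))) (Suc m)
    (split_matrix (Some ` T) m (copy_column e A))"
proof -
  let ?E = "insert None (Some ` ground M)"
  have "represents m (copy_column e A) (vector_matroid ?E m (copy_column e A))"
    by (simp add: represents_def vector_matroid_def)
  from element_splitting_eq[OF this, of "Some ` T"] assms(2)
  show ?thesis unfolding es_splitting_def parallel_copy_eq[OF assms] by (simp add: vector_matroid_def)
qed

lemma binary_es_splitting:
  assumes "binary M" "e \<in> ground M"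
  shows "binary (es_splitting M T e)"
proof -
  obtain m and A :: "nat \<Rightarrow> 'a \<Rightarrow> bit" where rep: "represents m A M" and fin: "finite (ground M)"
    using assms(1) matroid.finite_ground unfolding binary_def by auto
  have "represents n A' (vector_matroid E n A')" for n E and A' :: "nat \<Rightarrow> 'a option option \<Rightarrow> bit"
    by (simp add: represents_def vector_matroid_def)
  then show ?thesis
    unfolding binary_def es_splitting_eq[OF rep fin assms(2)]
    using matroid_vector_matroid fin by (metis finite_imageI finite_insert)
qed

lemma equal_or_disjoint_Some:
  "S = S' \<or> S \<inter> S' = {} \<Longrightarrow> Some ` S = Some ` S' \<or> Some ` S \<inter> Some ` S' = {}"
  by auto

text \<open>
  Up to \<open>None\<close>, the fundamental sets of the es-splitting are those of \<open>M\<close> together with the one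
  of the copy of \<open>e\<close>, which is \<open>{e}\<close> or \<open>F e\<close>.
\<close>

lemma gammoid_es_splitting:
  assumes bin: "binary M" and e: "e \<in> ground M" and no_minor: "\<not> has_minor_iso M (cycle_matroid G7)"
  shows "gammoid (es_splitting M T e)"
proof -
  let ?E = "ground M"
  obtain m and A :: "nat \<Rightarrow> 'a \<Rightarrow> bit" where rep: "represents m A M" and fin: "finite ?E"
    using bin matroid.finite_ground unfolding binary_def by auto
  obtain B F where ff: "fundamental_family m A ?E B F" and avoid: "\<And>p. p \<in> ?E - B \<Longrightarrow> e \<notin> F p"
    using fundamental_family_avoiding[OF fin e] by metis
  have disj: "F p = F q \<or> F p \<inter> F q = {}" if "p \<in> ?E - B" "q \<in> ?E - B" for p q
    using G7_minor_if_fundamental_sets_overlap[OF rep ff that] no_minor by metis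
  let ?F = "case_option (Some ` (if e \<in> B then {e} else F e)) (\<lambda>p. Some ` F p)"
  note ff1 = fundamental_family_copy_column[OF ff e]
  have disj1: "?F y = ?F z \<or> ?F y \<inter> ?F z = {}"
    if "y \<in> insert None (Some ` ?E) - Some ` B" "z \<in> insert None (Some ` ?E) - Some ` B" for y z
  proof -
    have copy: "(if e \<in> B then {e} else F e) = F p \<or> (if e \<in> B then {e} else F e) \<inter> F p = {}"
      if p: "p \<in> ?E - B" for p
    proof (cases "e \<in> B")
      case True
      then show ?thesis using avoid[OF p] by simp
    next
      case False
      then show ?thesis using disj[of e p] p e by simp
    qed
    show ?thesis
    proof (cases y; cases z)
      fix p q assume yz: "y = Some p" "z = Some q"
      then have pq: "p \<in> ?E - B" "q \<in> ?E - B" using that by auto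
      show ?thesis using equal_or_disjoint_Some[OF disj[OF pq]] yz by simp
    next
      fix q assume yz: "y = None" "z = Some q"
      then have q: "q \<in> ?E - B" using that by auto
      show ?thesis using equal_or_disjoint_Some[OF copy[OF q]] yz by simp
    next
      fix p assume yz: "y = Some p" "z = None"
      then have p: "p \<in> ?E - B" using that by auto
      show ?thesis using equal_or_disjoint_Some[OF copy[OF p]] yz by (simp add: Int_commute eq_commute)
    next
      assume "y = None" "z = None"
      then show ?thesis by simp
    qed
  qed
  show ?thesis
    unfolding es_splitting_eq[OF rep fin e]
  proof (rule gammoid_fundamental_family[OF fundamental_family_split_matrix[OF ff1], where a = None])
    fix y z
    assume y: "y \<in> insert None (Some ` insert None (Some ` ?E)) - insert None (Some ` Some ` B)"
      and z: "z \<in> insert None (Some ` insert None (Some ` ?E)) - insert None (Some ` Some ` B)"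
    obtain y' where y': "y = Some y'" "y' \<in> insert None (Some ` ?E) - Some ` B"
      using y by (cases y) auto
    obtain z' where z': "z = Some z'" "z' \<in> insert None (Some ` ?E) - Some ` B"
      using z by (cases z) auto
    let ?G = "\<lambda>H. case_option {} (\<lambda>p. Some ` ?F p \<union>
      (if (if p \<in> H then 1 else 0) + (\<Sum>b\<in>?F p. if b \<in> H then 1 else 0 :: bit) = 0 then {} else {None}))"
    have strip: "?G H (Some p) - {None} = Some ` ?F p" for H p by auto
    show "?G (Some ` T) y - {None} = ?G (Some ` T) z - {None} \<or>
        (?G (Some ` T) y - {None}) \<inter> (?G (Some ` T) z - {None}) = {}"
      unfolding y' z' strip by (rule equal_or_disjoint_Some[OF disj1[OF y'(2) z'(2)]])
  qed
qed

section \<open>Splittings that are not gammoids\<close>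

lemma matroid_delete:
  assumes "matroid M"
  shows "matroid (delete M X)"
proof -
  interpret matroid M by fact
  show ?thesis
  proof
    show "finite (ground (delete M X))" using finite_ground by (simp add: delete_def)
    show "indep (delete M X) I \<Longrightarrow> I \<subseteq> ground (delete M X)" for I
      using indep_subset_ground[of I] by (auto simp: delete_def)
    show "indep (delete M X) {}" using indep_empty by (simp add: delete_def)
    show "indep (delete M X) I \<Longrightarrow> I' \<subseteq> I \<Longrightarrow> indep (delete M X) I'" for I I'
      using indep_subset[of I I'] by (auto simp: delete_def)
    fix I I' assume I: "indep (delete M X) I" "indep (delete M X) I'" "card I < card I'"
    then obtain y where "y \<in> I' - I" "indep M (insert y I)"
      using indep_exchange[of I I'] by (auto simp: delete_def)
    then show "\<exists>y\<in>I' - I. indep (delete M X) (insert y I)"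
      using I by (auto simp: delete_def)
  qed
qed

context matroid
begin

lemma finite_indep: "indep M I \<Longrightarrow> finite I"
  using indep_subset_ground finite_ground finite_subset by metis

lemma card_basis_of_le:
  assumes "basis_of M Y J" "basis_of M Y J'"
  shows "card J' \<le> card J"
proof (rule ccontr)
  assume "\<not> card J' \<le> card J"
  then obtain y where "y \<in> J' - J" "indep M (insert y J)"
    using indep_exchange[of J J'] assms unfolding basis_of_def by auto
  then show False using assms unfolding basis_of_def
    by (metis DiffD1 DiffD2 insertI1 insert_subset subset_iff subset_insertI)
qed

text \<open>
  Contraction is defined with some basis of the contracted set, possibly a different one for each
  independent set. To work with one fixed \<open>J\<close>, it has to be shown that the choice is immaterial:
  when \<open>J\<close> is augmented from \<open>I \<union> J'\<close>, no element of \<open>J'\<close> can be added, so all of \<open>I\<close> is.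
\<close>

lemma indep_Un_basis_change:
  assumes J: "basis_of M Y J" and J': "basis_of M Y J'"
    and I: "indep M (I \<union> J')" "I \<inter> Y = {}"
  shows "indep M (I \<union> J)"
proof -
  have JY: "J \<subseteq> Y" "J' \<subseteq> Y" "indep M J" using J J' by (auto simp: basis_of_def)
  have fin: "finite I" "finite J" "finite J'"
    using finite_indep[OF I(1)] finite_indep[OF JY(3)] by auto
  let ?S = "{K. J \<subseteq> K \<and> K \<subseteq> I \<union> J \<and> indep M K}"
  have "?S \<subseteq> Pow (I \<union> J)" by auto
  then have "finite ?S" using fin by (auto intro: finite_subset)
  moreover have "J \<in> ?S" using JY by auto
  ultimately obtain K where K: "K \<in> ?S" and max: "\<forall>L\<in>?S. K \<subseteq> L \<longrightarrow> K = L"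
    using finite_has_maximal2[of ?S J] by auto
  have "card (I \<union> J') \<le> card K"
  proof (rule ccontr)
    assume "\<not> card (I \<union> J') \<le> card K"
    then obtain y where y: "y \<in> (I \<union> J') - K" "indep M (insert y K)"
      using indep_exchange[of K "I \<union> J'"] I(1) K by auto
    show False
    proof (cases "y \<in> I")
      case True
      then have "insert y K \<in> ?S" using K y by auto
      from max[rule_format, OF this subset_insertI] show False using y(1) by (metis DiffD2 insertI1)
    next
      case False
      then have "y \<in> Y" using y(1) JY by auto
      moreover have "insert y J \<subseteq> insert y K" using K by auto
      then have "indep M (insert y J)" using y(2) indep_subset by metis
      ultimately have "y \<in> J"
        using J unfolding basis_of_def by (metis insertI1 insert_subset subset_insertI)
      then show False using y(1) K by auto
    qed
  qed
  moreover have "card (I \<union> J) = card (I \<union> J')"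
  proof -
    have "card J = card J'" using card_basis_of_le[OF J J'] card_basis_of_le[OF J' J] by simp
    moreover have "I \<inter> J = {}" "I \<inter> J' = {}" using I(2) JY by auto
    ultimately show ?thesis using fin by (simp add: card_Un_disjoint)
  qed
  ultimately have "K = I \<union> J" using card_seteq[of "I \<union> J" K] K fin by simp
  then show ?thesis using K by simp
qed

lemma indep_contract_iff:
  assumes "basis_of M Y J" "I \<subseteq> ground M - Y"
  shows "indep (contract M Y) I \<longleftrightarrow> indep M (I \<union> J)"
proof -
  have "I \<inter> Y = {}" using assms(2) by auto
  then show ?thesis
    using indep_Un_basis_change[OF assms(1)] assms by (auto simp: contract_def)
qed

end

text \<open>
  In a zero-sum set \<open>W\<close> the copy \<open>Some None\<close> toggles the membership of \<open>e\<close> in its old part \<open>S\<close>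
  but does not count for the new row.
\<close>

lemma zero_sum_es_splitting_matrix:
  assumes W: "finite W" and S: "S = {x. Some (Some x) \<in> W}"
  shows "zero_sum (Suc m) (split_matrix (Some ` T) m (copy_column e A)) W \<longleftrightarrow>
    zero_sum m A (if (Some None \<in> W) = (e \<in> S) then S - {e} else insert e S) \<and>
    (None \<in> W \<longleftrightarrow> odd (card (S \<inter> T)))"
proof -
  let ?W = "{x. Some x \<in> W}"
  have fin: "finite ?W" using finite_vimageI[OF W, of Some] by (simp add: vimage_def)
  have finS: "finite S" using finite_vimageI[OF fin, of Some] by (simp add: vimage_def S)
  have S1: "{x. Some x \<in> ?W} - {e} = S - {e}" by (simp add: S)
  have "(\<Sum>x\<in>?W. if x \<in> Some ` T then 1 else 0 :: bit) = (\<Sum>x\<in>S. if x \<in> T then 1 else 0)"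
    unfolding sum_option[OF fin] by (auto simp: S intro!: sum.cong)
  also have "\<dots> = (if odd (card (S \<inter> T)) then 1 else 0)"
    unfolding sum_indicator_bit[OF finS] by (simp add: Int_def)
  finally have parity: "(\<Sum>x\<in>?W. if x \<in> Some ` T then 1 else 0 :: bit) =
    (if odd (card (S \<inter> T)) then 1 else 0)" .
  have copied: "(if (None \<in> ?W) = (Some e \<in> ?W) then S - {e} else insert e (S - {e})) =
      (if (Some None \<in> W) = (e \<in> S) then S - {e} else insert e S)"
    by (simp add: S)
  show ?thesis
    unfolding zero_sum_split_matrix[OF W] zero_sum_copy_column[OF fin _ S1, of m A, simplified] parity
    using copied by (simp add: add_self_bit)
qed

text \<open>
  A minimal dependent set of a contraction lifts to a zero-sum set by adding contracted elements.
\<close>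

lemma circuit_over_indep_set:
  fixes A :: "nat \<Rightarrow> 'a \<Rightarrow> bit"
  assumes fin: "finite S" "finite J" and dep: "\<not> columns_indep m A (S \<union> J)"
    and sub: "\<And>x. x \<in> S \<Longrightarrow> columns_indep m A ((S - {x}) \<union> J)"
  shows "\<exists>K\<subseteq>J. zero_sum m A (S \<union> K)"
proof -
  obtain Z where Z: "Z \<subseteq> S \<union> J" "zero_sum m A Z" "Z \<noteq> {}"
    using dep fin columns_indep_iff[of "S \<union> J" m A] by auto
  have "x \<in> Z" if x: "x \<in> S" for x
  proof (rule ccontr)
    assume "x \<notin> Z"
    then have "Z \<subseteq> (S - {x}) \<union> J" using Z(1) by auto
    then show False using sub[OF x] Z(2,3) fin columns_indep_iff[of "(S - {x}) \<union> J" m A] by auto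
  qed
  then have "S \<union> (Z \<inter> J) = Z" using Z(1) by auto
  then show ?thesis using Z(2) by (intro exI[of _ "Z \<inter> J"]) auto
qed

text \<open>
  The minor in concrete terms: contraction of \<open>J\<close> leaves the triangles \<open>{p, q, r}\<close> and
  \<open>{p, q, s}\<close> and the parallel pair \<open>{r, s}\<close>.
\<close>

lemma G7_minor_elements:
  assumes M: "matroid M" and minor: "has_minor_iso M (cycle_matroid G7)"
  shows "\<exists>p q r s J. distinct [p, q, r, s] \<and> {p, q, r, s} \<subseteq> ground M \<and> J \<subseteq> ground M \<and>
    {p, q, r, s} \<inter> J = {} \<and>
    (\<forall>S\<subseteq>{p, q, r, s}. indep M (S \<union> J) \<longleftrightarrow>
      \<not> {r, s} \<subseteq> S \<and> \<not> {p, q, r} \<subseteq> S \<and> \<not> {p, q, s} \<subseteq> S)"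
proof -
  obtain N where N: "is_minor N M" "matroid_iso N (cycle_matroid G7)"
    using minor unfolding has_minor_iso_def by metis
  obtain X Y where XY: "X \<subseteq> ground M" "Y \<subseteq> ground M" "X \<inter> Y = {}" "N = contract (delete M X) Y"
    using N(1) unfolding is_minor_def by metis
  obtain f where f: "bij_betw f (ground N) {0, 1, 2, 3 :: nat}"
    and iso: "\<And>S. S \<subseteq> ground N \<Longrightarrow> indep N S \<longleftrightarrow> indep (cycle_matroid G7) (f ` S)"
    using N(2) unfolding matroid_iso_def ground_cycle_matroid_G7 by metis
  have inj: "inj_on f (ground N)" and surj: "f ` ground N = {0, 1, 2, 3}"
    using f by (auto simp: bij_betw_def)
  have preimage: "\<exists>x\<in>ground N. f x = k" if "k \<in> {0, 1, 2, 3}" for k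
    using that unfolding surj[symmetric] by auto
  obtain p q r s where el: "p \<in> ground N" "q \<in> ground N" "r \<in> ground N" "s \<in> ground N"
    and fe: "f p = 0" "f q = 1" "f r = 2" "f s = 3"
    using preimage[of 0] preimage[of 1] preimage[of 2] preimage[of 3] by auto
  have ground_N: "ground N = ground M - X - Y" by (simp add: XY(4) contract_def delete_def)
  have "indep N {}" using iso[of "{}"] by (simp add: indep_cycle_matroid_G7)
  then obtain J where J: "basis_of (delete M X) Y J" by (auto simp: XY(4) contract_def)
  then have JY: "J \<subseteq> Y" and JX: "J \<inter> X = {}" by (auto simp: basis_of_def delete_def)
  have "indep M (S \<union> J) \<longleftrightarrow> \<not> {r, s} \<subseteq> S \<and> \<not> {p, q, r} \<subseteq> S \<and> \<not> {p, q, s} \<subseteq> S"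
    if S: "S \<subseteq> {p, q, r, s}" for S
  proof -
    have SN: "S \<subseteq> ground N" using S el by auto
    have mem: "x \<in> S \<longleftrightarrow> f x \<in> f ` S" if "x \<in> ground N" for x
      using inj_on_image_mem_iff[OF inj that SN] by simp
    have "f ` S \<subseteq> {0, 1, 2, 3}" using S fe by auto
    have "S \<inter> X = {}" "S \<subseteq> ground (delete M X) - Y"
      using SN by (auto simp: ground_N delete_def)
    then have "indep M (S \<union> J) \<longleftrightarrow> indep (delete M X) (S \<union> J)"
      using JX by (auto simp: delete_def)
    also have "\<dots> \<longleftrightarrow> indep N S"
      using matroid.indep_contract_iff[OF matroid_delete[OF M] J] \<open>S \<subseteq> ground (delete M X) - Y\<close>
      by (simp add: XY(4))
    also have "\<dots> \<longleftrightarrow> \<not> {r, s} \<subseteq> S \<and> \<not> {p, q, r} \<subseteq> S \<and> \<not> {p, q, s} \<subseteq> S"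
      unfolding iso[OF SN] indep_cycle_matroid_G7
      using \<open>f ` S \<subseteq> {0, 1, 2, 3}\<close> mem[OF el(1)] mem[OF el(2)] mem[OF el(3)] mem[OF el(4)]
      unfolding fe by simp
    finally show ?thesis .
  qed
  moreover have "distinct [p, q, r, s]" using fe by auto
  moreover have "{p, q, r, s} \<subseteq> ground M" "J \<subseteq> ground M" "{p, q, r, s} \<inter> J = {}"
    using el JY XY(2) by (auto simp: ground_N)
  ultimately show ?thesis by metis
qed

text \<open>
  Modulo \<open>J\<close>, the triangles of the resulting \<open>K\<^sub>4\<close> are \<open>{r, s, a}\<close>, \<open>{p, q, r}\<close>, \<open>{q, s, \<gamma>}\<close>
  and \<open>{p, \<gamma>, a}\<close>. In the exchange between \<open>{p, s, a}\<close> and \<open>{q, r, \<gamma>}\<close> they exclude the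
  partners \<open>r\<close> and \<open>\<gamma>\<close> both for \<open>p\<close> and for \<open>s\<close>, so the two elements compete for the single
  partner \<open>q\<close>.
\<close>

lemma not_gammoid_es_splitting:
  assumes bin: "binary M" and dist: "distinct [p, q, r, s]"
    and pqrs: "{p, q, r, s} \<subseteq> ground M" and J: "J \<subseteq> ground M" "{p, q, r, s} \<inter> J = {}"
    and pattern: "\<And>S. S \<subseteq> {p, q, r, s} \<Longrightarrow> indep M (S \<union> J) \<longleftrightarrow>
      \<not> {r, s} \<subseteq> S \<and> \<not> {p, q, r} \<subseteq> S \<and> \<not> {p, q, s} \<subseteq> S"
  shows "\<not> gammoid (es_splitting M {p, r} p)"
proof
  assume gam: "gammoid (es_splitting M {p, r} p)"
  obtain m and A :: "nat \<Rightarrow> 'a \<Rightarrow> bit" where rep: "represents m A M" and finM: "finite (ground M)"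
    using bin matroid.finite_ground unfolding binary_def by auto
  let ?M = "es_splitting M {p, r} p"
  let ?E = "insert None (Some ` insert None (Some ` ground M))"
  let ?A = "split_matrix (Some ` {p, r}) m (copy_column p A)"
  define old :: "'a \<Rightarrow> 'a option option" where "old x = Some (Some x)" for x
  define \<gamma> :: "'a option option" where "\<gamma> = Some None"
  define a :: "'a option option" where "a = None"
  note new_defs = old_def \<gamma>_def a_def
  have finJ: "finite J" using J(1) finM by (rule finite_subset)
  have ind_M: "indep M Z \<longleftrightarrow> Z \<subseteq> ground M \<and> columns_indep m A Z" for Z
    using rep unfolding represents_def by (metis indep_system.select_convs(2) vector_matroid_def)
  have cols: "columns_indep m A (S \<union> J) \<longleftrightarrow>
      \<not> {r, s} \<subseteq> S \<and> \<not> {p, q, r} \<subseteq> S \<and> \<not> {p, q, s} \<subseteq> S" if S: "S \<subseteq> {p, q, r, s}" for S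
  proof -
    have "S \<union> J \<subseteq> ground M" using S pqrs J(1) by (metis Un_least order_trans)
    then show ?thesis using pattern[OF S] ind_M by metis
  qed
  have pr: "p \<in> ground M" using pqrs by simp
  have ind: "indep ?M W \<longleftrightarrow> W \<subseteq> ?E \<and> columns_indep (Suc m) ?A W" for W
    unfolding es_splitting_eq[OF rep finM pr] by (simp only: vector_matroid_def indep_system.select_convs)
  have finE: "finite ?E" using finM by simp
  have zs: "zero_sum (Suc m) ?A W \<longleftrightarrow>
      zero_sum m A (if (\<gamma> \<in> W) = (p \<in> S) then S - {p} else insert p S) \<and>
      (a \<in> W \<longleftrightarrow> odd (card (S \<inter> {p, r})))"
    if "finite W" "S = {x. old x \<in> W}" for W S
    unfolding new_defs by (rule zero_sum_es_splitting_matrix) (use that in \<open>simp_all add: old_def\<close>)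
  have dependent: "\<not> indep ?M Y"
    if W: "W \<subseteq> Y" "W \<noteq> {}" and S: "finite W" "S = {x. old x \<in> W}"
      "zero_sum m A (if (\<gamma> \<in> W) = (p \<in> S) then S - {p} else insert p S)"
      "a \<in> W \<longleftrightarrow> odd (card (S \<inter> {p, r}))" for W Y S
  proof
    assume Y: "indep ?M Y"
    then have "finite Y" using ind finE finite_subset by metis
    moreover have "zero_sum (Suc m) ?A W" using zs[OF S(1,2)] S(3,4) by simp
    ultimately show False using Y W ind columns_indep_iff[of Y "Suc m" ?A] by metis
  qed
  have circuit: "\<exists>K\<subseteq>J. zero_sum m A (S \<union> K)"
    if S: "S \<subseteq> {p, q, r, s}" "{r, s} \<subseteq> S \<or> {p, q, r} \<subseteq> S \<or> {p, q, s} \<subseteq> S"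
      "\<And>x. x \<in> S \<Longrightarrow> \<not> {r, s} \<subseteq> S - {x} \<and> \<not> {p, q, r} \<subseteq> S - {x} \<and> \<not> {p, q, s} \<subseteq> S - {x}" for S
  proof (rule circuit_over_indep_set[OF _ finJ])
    show "finite S" using S(1) by (rule finite_subset) simp
    show "\<not> columns_indep m A (S \<union> J)" using cols[OF S(1)] S(2) by metis
    fix x assume x: "x \<in> S"
    have "S - {x} \<subseteq> {p, q, r, s}" using S(1) by auto
    from cols[OF this] show "columns_indep m A (S - {x} \<union> J)" using S(3)[OF x] by metis
  qed
  obtain J1 where J1: "J1 \<subseteq> J" "zero_sum m A ({r, s} \<union> J1)"
  proof -
    have "\<exists>K\<subseteq>J. zero_sum m A ({r, s} \<union> K)"
      by (rule circuit) (use dist in auto)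
    then show thesis using that by metis
  qed
  obtain J2 where J2: "J2 \<subseteq> J" "zero_sum m A ({p, q, r} \<union> J2)"
  proof -
    have "\<exists>K\<subseteq>J. zero_sum m A ({p, q, r} \<union> K)"
      by (rule circuit) (use dist in auto)
    then show thesis using that by metis
  qed
  obtain J3 where J3: "J3 \<subseteq> J" "zero_sum m A ({p, q, s} \<union> J3)"
  proof -
    have "\<exists>K\<subseteq>J. zero_sum m A ({p, q, s} \<union> K)"
      by (rule circuit) (use dist in auto)
    then show thesis using that by metis
  qed
  have outJ: "p \<notin> J" "q \<notin> J" "r \<notin> J" "s \<notin> J" using J(2) by auto
  have new: "old x \<noteq> \<gamma>" "old x \<noteq> a" "\<gamma> \<noteq> old x" "a \<noteq> old x" "\<gamma> \<noteq> a" "a \<noteq> \<gamma>"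
    "old x = old y \<longleftrightarrow> x = y" for x y by (auto simp: new_defs)
  have inv: "{x. old x \<in> old ` S} = S" "{x. old x \<in> insert a (old ` S)} = S"
    "{x. old x \<in> insert \<gamma> (old ` S)} = S" "{x. old x \<in> insert \<gamma> (insert a (old ` S))} = S" for S
    by (auto simp: new)
  have finK: "finite K" if "K \<subseteq> J" for K using that finJ by (rule finite_subset)
  \<comment> \<open>Each triangle, and the circuit \<open>{q, r, \<gamma>, a}\<close>, is dependent together with \<open>J\<close>; the parity of the old elements in \<open>{p, r}\<close> decides whether \<open>a\<close> takes part.\<close>
  have D_rsa: "\<not> indep ?M Y" if Y: "insert a (old ` ({r, s} \<union> J)) \<subseteq> Y" for Y
  proof (rule dependent[where W = "insert a (old ` ({r, s} \<union> J1))", OF _ _ _ inv(2)[symmetric]])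
    show "insert a (old ` ({r, s} \<union> J1)) \<subseteq> Y" using Y J1(1) by auto
    have "p \<notin> {r, s} \<union> J1" using dist outJ J1(1) by auto
    moreover have "({r, s} \<union> J1) \<inter> {p, r} = {r}" using dist outJ J1(1) by auto
    moreover have "\<gamma> \<notin> insert a (old ` ({r, s} \<union> J1))" by (auto simp: new)
    ultimately show "zero_sum m A (if (\<gamma> \<in> insert a (old ` ({r, s} \<union> J1))) = (p \<in> {r, s} \<union> J1)
        then ({r, s} \<union> J1) - {p} else insert p ({r, s} \<union> J1))"
      "(a \<in> insert a (old ` ({r, s} \<union> J1))) = odd (card (({r, s} \<union> J1) \<inter> {p, r}))"
      using J1(2) by simp_all
  qed (use finK[OF J1(1)] in simp_all)
  have D_pqr: "\<not> indep ?M Y" if Y: "old ` ({p, q, r} \<union> J) \<subseteq> Y" for Y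
  proof (rule dependent[where W = "old ` ({p, q, r} \<union> J2)", OF _ _ _ inv(1)[symmetric]])
    show "old ` ({p, q, r} \<union> J2) \<subseteq> Y" using Y J2(1) by auto
    have "({p, q, r} \<union> J2) \<inter> {p, r} = {p, r}" by auto
    moreover have "card {p, r} = 2" using dist by simp
    moreover have "\<gamma> \<notin> old ` ({p, q, r} \<union> J2)" "a \<notin> old ` ({p, q, r} \<union> J2)" by (auto simp: new)
    ultimately show "zero_sum m A (if (\<gamma> \<in> old ` ({p, q, r} \<union> J2)) = (p \<in> {p, q, r} \<union> J2)
        then ({p, q, r} \<union> J2) - {p} else insert p ({p, q, r} \<union> J2))"
      "(a \<in> old ` ({p, q, r} \<union> J2)) = odd (card (({p, q, r} \<union> J2) \<inter> {p, r}))"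
      using J2(2) by (simp_all add: insert_absorb)
  qed (use finK[OF J2(1)] in simp_all)
  have D_qsg: "\<not> indep ?M Y" if Y: "insert \<gamma> (old ` ({q, s} \<union> J)) \<subseteq> Y" for Y
  proof (rule dependent[where W = "insert \<gamma> (old ` ({q, s} \<union> J3))", OF _ _ _ inv(3)[symmetric]])
    show "insert \<gamma> (old ` ({q, s} \<union> J3)) \<subseteq> Y" using Y J3(1) by auto
    have "p \<notin> {q, s} \<union> J3" using dist outJ J3(1) by auto
    moreover have "({q, s} \<union> J3) \<inter> {p, r} = {}" using dist outJ J3(1) by auto
    moreover have "a \<notin> insert \<gamma> (old ` ({q, s} \<union> J3))" by (auto simp: new)
    ultimately show "zero_sum m A (if (\<gamma> \<in> insert \<gamma> (old ` ({q, s} \<union> J3))) = (p \<in> {q, s} \<union> J3)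
        then ({q, s} \<union> J3) - {p} else insert p ({q, s} \<union> J3))"
      "(a \<in> insert \<gamma> (old ` ({q, s} \<union> J3))) = odd (card (({q, s} \<union> J3) \<inter> {p, r}))"
      using J3(2) by simp_all
  qed (use finK[OF J3(1)] in simp_all)
  have D_qrga: "\<not> indep ?M Y" if Y: "insert \<gamma> (insert a (old ` ({q, r} \<union> J))) \<subseteq> Y" for Y
  proof (rule dependent[where W = "insert \<gamma> (insert a (old ` ({q, r} \<union> J2)))", OF _ _ _ inv(4)[symmetric]])
    show "insert \<gamma> (insert a (old ` ({q, r} \<union> J2))) \<subseteq> Y" using Y J2(1) by auto
    have "p \<notin> {q, r} \<union> J2" using dist outJ J2(1) by auto
    moreover have "({q, r} \<union> J2) \<inter> {p, r} = {r}" using dist outJ J2(1) by auto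
    ultimately show "zero_sum m A (if (\<gamma> \<in> insert \<gamma> (insert a (old ` ({q, r} \<union> J2)))) = (p \<in> {q, r} \<union> J2)
        then ({q, r} \<union> J2) - {p} else insert p ({q, r} \<union> J2))"
      "(a \<in> insert \<gamma> (insert a (old ` ({q, r} \<union> J2)))) = odd (card (({q, r} \<union> J2) \<inter> {p, r}))"
      using J2(2) by simp_all
  qed (use finK[OF J2(1)] in simp_all)
  have D_pga: "\<not> indep ?M Y" if Y: "insert \<gamma> (insert a (old ` {p})) \<subseteq> Y" for Y
  proof (rule dependent[where W = "insert \<gamma> (insert a (old ` {p}))", OF Y _ _ inv(4)[symmetric]])
    show "zero_sum m A (if (\<gamma> \<in> insert \<gamma> (insert a (old ` {p}))) = (p \<in> {p}) then {p} - {p} else insert p {p})"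
      by (simp add: zero_sum_def)
    show "(a \<in> insert \<gamma> (insert a (old ` {p}))) = odd (card ({p} \<inter> {p, r}))" by simp
  qed simp_all
  define X1 where "X1 = insert a (old ` ({p, s} \<union> J))"
  define X2 where "X2 = insert \<gamma> (old ` ({q, r} \<union> J))"
  have in_E: "old ` ground M \<subseteq> ?E" "a \<in> ?E" "\<gamma> \<in> ?E" by (auto simp: new_defs)
  have sub_E: "insert z (old ` S) \<subseteq> ?E" if "z \<in> ?E" "S \<subseteq> ground M" for z S
    using that(1) order_trans[OF image_mono[OF that(2)] in_E(1)] by (simp only: insert_subset)
  have X_E: "X1 \<subseteq> ?E" "X2 \<subseteq> ?E"
    unfolding X1_def X2_def using pqrs J(1) by (intro sub_E in_E; simp)+
  then have finX: "finite X1" "finite X2" using finE finite_subset by metis+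
  have indX1: "indep ?M X1"
    unfolding ind columns_indep_iff[OF finX(1)]
  proof (intro conjI allI impI X_E)
    fix W assume W: "W \<subseteq> X1" "zero_sum (Suc m) ?A W"
    define S where "S = {x. old x \<in> W}"
    have finW: "finite W" using W(1) finX(1) by (rule finite_subset)
    have SJ: "S \<subseteq> {p, s} \<union> J" using W(1) by (auto simp: S_def X1_def new)
    have "\<gamma> \<notin> W" using W(1) by (auto simp: X1_def new)
    then have S: "zero_sum m A S" "a \<in> W \<longleftrightarrow> odd (card (S \<inter> {p, r}))"
      using W(2) zs[OF finW S_def] by (auto simp: insert_absorb split: if_splits)
    have "columns_indep m A ({p, s} \<union> J)" using cols[of "{p, s}"] dist by auto
    then have "S = {}" using SJ S(1) finJ columns_indep_iff[of "{p, s} \<union> J" m A] by simp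
    then have "a \<notin> W" using S(2) by simp
    then show "W = {}" using \<open>S = {}\<close> W(1) by (auto simp: S_def X1_def)
  qed
  have indX2: "indep ?M X2"
    unfolding ind columns_indep_iff[OF finX(2)]
  proof (intro conjI allI impI X_E)
    fix W assume W: "W \<subseteq> X2" "zero_sum (Suc m) ?A W"
    define S where "S = {x. old x \<in> W}"
    have finW: "finite W" using W(1) finX(2) by (rule finite_subset)
    have SJ: "S \<subseteq> {q, r} \<union> J" using W(1) by (auto simp: S_def X2_def new)
    have pS: "p \<notin> S" using SJ dist outJ by auto
    have "a \<notin> W" using W(1) by (auto simp: X2_def new)
    then have S: "zero_sum m A (if \<gamma> \<in> W then insert p S else S)" "even (card (S \<inter> {p, r}))"
      using W(2) zs[OF finW S_def] pS by auto
    \<comment> \<open>Without \<open>a\<close> the number of elements in \<open>{p, r}\<close> is even, and \<open>p\<close> itself is absent.\<close>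
    have "r \<notin> S"
    proof
      assume "r \<in> S"
      then have "S \<inter> {p, r} = {r}" using pS by auto
      then show False using S(2) by simp
    qed
    then have sub: "(if \<gamma> \<in> W then insert p S else S) \<subseteq> {p, q} \<union> J" using SJ by auto
    have "columns_indep m A ({p, q} \<union> J)" using cols[of "{p, q}"] dist by auto
    then have none: "(if \<gamma> \<in> W then insert p S else S) = {}"
      using sub S(1) finJ columns_indep_iff[of "{p, q} \<union> J" m A] by simp
    then have "\<gamma> \<notin> W" "S = {}" by (auto split: if_splits)
    then show "W = {}" using W(1) by (auto simp: S_def X2_def)
  qed
  have diff: "X1 - X2 = {old p, old s, a}" "X2 - X1 = {old q, old r, \<gamma>}"
    using dist outJ by (auto simp: X1_def X2_def new)
  have span: "\<not> indep ?M (insert x X2)" if "x \<in> X1 - X2" for x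
  proof -
    have "x = old p \<or> x = old s \<or> x = a" using that diff by simp
    then show ?thesis
    proof (elim disjE)
      assume "x = old p"
      then show ?thesis by (intro D_pqr) (auto simp: X2_def)
    next
      assume "x = old s"
      then show ?thesis by (intro D_qsg) (auto simp: X2_def)
    next
      assume "x = a"
      then show ?thesis by (intro D_qrga) (auto simp: X2_def)
    qed
  qed
  from gammoid_symmetric_exchange[OF gam indX1 indX2 span]
  obtain \<sigma> where \<sigma>0: "inj_on \<sigma> (X1 - X2) \<and> (\<forall>x\<in>X1 - X2. \<sigma> x \<in> X2 - X1 \<and>
      indep ?M (insert (\<sigma> x) (X1 - {x})) \<and> indep ?M (insert x (X2 - {\<sigma> x})))"
    by (rule exE)
  note inj = \<sigma>0[THEN conjunct1, unfolded diff] and \<sigma> = \<sigma>0[THEN conjunct2, THEN bspec, unfolded diff]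
  have "\<sigma> (old p) = old q"
  proof -
    have "\<sigma> (old p) \<noteq> \<gamma>"
    proof
      assume "\<sigma> (old p) = \<gamma>"
      moreover have "\<not> indep ?M (insert (old p) (X2 - {\<gamma>}))"
        by (rule D_pqr) (auto simp: X2_def new)
      ultimately show False using \<sigma>[of "old p"] by simp
    qed
    moreover have "\<sigma> (old p) \<noteq> old r"
    proof
      assume "\<sigma> (old p) = old r"
      moreover have "\<not> indep ?M (insert (old r) (X1 - {old p}))"
        by (rule D_rsa) (use dist outJ in \<open>auto simp: X1_def new\<close>)
      ultimately show False using \<sigma>[of "old p"] by simp
    qed
    ultimately show ?thesis using \<sigma>[of "old p"] by simp
  qed
  moreover have "\<sigma> (old s) = old q"
  proof -
    have "\<sigma> (old s) \<noteq> \<gamma>"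
    proof
      assume "\<sigma> (old s) = \<gamma>"
      moreover have "\<not> indep ?M (insert \<gamma> (X1 - {old s}))"
        by (rule D_pga) (use dist in \<open>auto simp: X1_def new\<close>)
      ultimately show False using \<sigma>[of "old s"] by simp
    qed
    moreover have "\<sigma> (old s) \<noteq> old r"
    proof
      assume "\<sigma> (old s) = old r"
      moreover have "\<not> indep ?M (insert (old s) (X2 - {old r}))"
        by (rule D_qsg) (use dist outJ in \<open>auto simp: X2_def new\<close>)
      ultimately show False using \<sigma>[of "old s"] by simp
    qed
    ultimately show ?thesis using \<sigma>[of "old s"] by simp
  qed
  ultimately have "old p = old s" using inj_onD[OF inj, of "old p" "old s"] by simp
  then show False using dist by (simp add: new)
qed

theorem theorem1p7:
  fixes M :: "'a indep_system"
  assumes "binary_gammoid M"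
  shows "(\<forall>T e. T \<subseteq> ground M \<and> card T \<ge> 2 \<and> e \<in> T \<longrightarrow> binary_gammoid (es_splitting M T e))
    \<longleftrightarrow> \<not> has_minor_iso M (cycle_matroid G7)"
proof
  have bin: "binary M" using assms by (simp add: binary_gammoid_def)
  then have mat: "matroid M" by (simp add: binary_def)
  assume all: "\<forall>T e. T \<subseteq> ground M \<and> card T \<ge> 2 \<and> e \<in> T \<longrightarrow> binary_gammoid (es_splitting M T e)"
  show "\<not> has_minor_iso M (cycle_matroid G7)"
  proof
    assume "has_minor_iso M (cycle_matroid G7)"
    then obtain p q r s J where el: "distinct [p, q, r, s]" "{p, q, r, s} \<subseteq> ground M" "J \<subseteq> ground M"
      "{p, q, r, s} \<inter> J = {}"
      "\<forall>S\<subseteq>{p, q, r, s}. indep M (S \<union> J) \<longleftrightarrow>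
        \<not> {r, s} \<subseteq> S \<and> \<not> {p, q, r} \<subseteq> S \<and> \<not> {p, q, s} \<subseteq> S"
      using G7_minor_elements[OF mat] by metis
    have "\<not> gammoid (es_splitting M {p, r} p)"
      by (rule not_gammoid_es_splitting[OF bin el(1-4)]) (rule el(5)[rule_format])
    moreover have "{p, r} \<subseteq> ground M \<and> card {p, r} \<ge> 2 \<and> p \<in> {p, r}" using el(1,2) by simp
    then have "binary_gammoid (es_splitting M {p, r} p)" using all by metis
    ultimately show False by (simp add: binary_gammoid_def)
  qed
next
  have bin: "binary M" using assms by (simp add: binary_gammoid_def)
  assume no_minor: "\<not> has_minor_iso M (cycle_matroid G7)"
  show "\<forall>T e. T \<subseteq> ground M \<and> card T \<ge> 2 \<and> e \<in> T \<longrightarrow> binary_gammoid (es_splitting M T e)"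
  proof (intro allI impI)
    fix T e assume "T \<subseteq> ground M \<and> card T \<ge> 2 \<and> e \<in> T"
    then have "e \<in> ground M" by auto
    then show "binary_gammoid (es_splitting M T e)"
      using gammoid_es_splitting[OF bin _ no_minor] binary_es_splitting[OF bin]
      by (simp add: binary_gammoid_def)
  qed
qed

end
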